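(* Let $\{\Lambda_m\}_{m\in\mathcal M}$, $\Lambda_m\in End^*_{\mathcal A}(U,V_m)$, be a $c$-$g$-Bessel system for $U$ with respect to $\{V_m\}_{m\in\mathcal M}$ with $c$-$g$-Bessel bound $B$. Then the mapping $T:\bigoplus_{m\in\mathcal M}V_m\to U$ defined, for $f=\{f_m\}_{m\in\mathcal M}\in\bigoplus_{m\in\mathcal M}V_m$, by $$\langle Tf,g\rangle=\int_{\mathcal M}\langle\Lambda_m^*f_m,g\rangle\,d\mu(m)\qquad\text{for all } g\in U,$$ is a bounded linear operator with $\|T\|\le\sqrt B$. Moreover, its adjoint operator is given by $T^*g=\{\Lambda_mg\}_{m\in\mathcal M}$ for all $g\in U$, and $S=TT^*$, where $S$ is the $c$-$g$-frame operator of $\{\Lambda_m\}_{m\in\mathcal M}$.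
   Context: $\mathcal A$ is a complex $C^*$-algebra; $U$ and $V$ are (left) Hilbert $\mathcal A$-modules, with $\mathcal A$-valued inner products that are $\mathcal A$-linear in the first variable and norm $\|f\|=\|\langle f,f\rangle\|^{1/2}$; $(\mathcal M,\mu)$ is a measure space with positive measure; $\{V_m\}_{m\in\mathcal M}$ is a family of closed submodules of $V$. $End^*_{\mathcal A}(X,Y)$ is the set of adjointable $\mathcal A$-linear maps $X\to Y$. Integrals of Banach-space-valued functions are weak (Pettis) integrals, and an (in)equality involving an integral includes the assertion that the integral exists. $\bigoplus_{m\in\mathcal M}V_m$ is the space of strongly measurable families $\{g_m\}_{m\in\mathcal M}$ (modulo a.e. equality) with $g_m\in V_m$ and $\left\|\int_{\mathcal M}|g_m|^2d\mu(m)\right\|<\infty$, where $|g_m|^2=\langle g_m,g_m\rangle$, with $\mathcal A$-valued inner product $\langle f,g\rangle=\int_{\mathcal M}\langle f_m,g_m\rangle d\mu(m)$; it is a standing assumption that this is a Hilbert $\mathcal A$-module. A family $\{\Lambda_m\}_{m\in\mathcal M}$ with $\Lambda_m\in End^*_{\mathcal A}(U,V_m)$ is a $c$-$g$-Bessel system for $U$ with respect to $\{V_m\}$ with bound $B>0$ if for every $f\in U$ the map $m\mapsto\Lambda_mf$ is strongly measurable and $\int_{\mathcal M}\langle\Lambda_mf,\Lambda_mf\rangle d\mu(m)\le B\langle f,f\rangle$ for all $f\in U$. Its $c$-$g$-frame operator $S:U\to U$ is $Sf=\int_{\mathcal M}\Lambda_m^*\Lambda_mf\,d\mu(m)$, i.e.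 $\langle Sf,g\rangle=\int_{\mathcal M}\langle\Lambda_m^*\Lambda_mf,g\rangle d\mu(m)$ for all $f,g\in U$.
   Formalization: The existence of a vector Tf in U satisfying the defining identity is assumed, since it can fail for general Hilbert modules; existence of the integrals of ⟨Λ_m^* f_m, g⟩ is proved, and the other claims are proved for every such T. *)

theory Defs
  imports "HOL-Analysis.Analysis"
begin

section \<open>Complex Banach spaces and C*-algebras\<close>

class complex_banach = banach +
  fixes scaleC :: "complex \<Rightarrow> 'a \<Rightarrow> 'a" (infixr "*\<^sub>C" 75)
  assumes scaleC_add_right: "c *\<^sub>C (x + y) = c *\<^sub>C x + c *\<^sub>C y"
    and scaleC_add_left: "(c + d) *\<^sub>C x = c *\<^sub>C x + d *\<^sub>C x"
    and scaleC_scaleC: "c *\<^sub>C d *\<^sub>C x = (c * d) *\<^sub>C x"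
    and scaleC_of_real: "complex_of_real r *\<^sub>C x = r *\<^sub>R x"
    and norm_scaleC: "norm (c *\<^sub>C x) = cmod c * norm x"

text \<open>No unit is required.\<close>

class cstar_algebra = complex_banach + real_normed_algebra +
  fixes star :: "'a \<Rightarrow> 'a"
  assumes mult_scaleC_left: "(c *\<^sub>C a) * b = c *\<^sub>C (a * b)"
    and mult_scaleC_right: "a * (c *\<^sub>C b) = c *\<^sub>C (a * b)"
    and star_star: "star (star a) = a"
    and star_add: "star (a + b) = star a + star b"
    and star_scaleC: "star (c *\<^sub>C a) = cnj c *\<^sub>C star a"
    and star_mult: "star (a * b) = star b * star a"
    and norm_star_mult: "norm (star a * a) = (norm a)\<^sup>2"

definition cpositive :: "'a::cstar_algebra \<Rightarrow> bool"
  where "cpositive a \<longleftrightarrow> (\<exists>b. a = star b * b)"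

definition cle :: "'a::cstar_algebra \<Rightarrow> 'a \<Rightarrow> bool"
  where "cle a b \<longleftrightarrow> cpositive (b - a)"

section \<open>Hilbert modules and adjointable maps\<close>

text \<open>Left Hilbert modules whose underlying set is a whole type. Completeness is part of
  the class \<^class>\<open>complex_banach\<close>; definiteness of the inner product follows from the
  last condition.\<close>

locale hilbert_cmodule =
  fixes act :: "'a::cstar_algebra \<Rightarrow> 'x::complex_banach \<Rightarrow> 'x"
    and ip :: "'x \<Rightarrow> 'x \<Rightarrow> 'a"
  assumes act_add_right: "act a (x + y) = act a x + act a y"
    and act_add_left: "act (a + b) x = act a x + act b x"
    and act_act: "act a (act b x) = act (a * b) x"
    and act_scaleC_left: "act (c *\<^sub>C a) x = c *\<^sub>C act a x"
    and act_scaleC_right: "act a (c *\<^sub>C x) = c *\<^sub>C act a x"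
    and ip_add_left: "ip (x + y) z = ip x z + ip y z"
    and ip_scaleC_left: "ip (c *\<^sub>C x) y = c *\<^sub>C ip x y"
    and ip_act_left: "ip (act a x) y = a * ip x y"
    and ip_star: "star (ip x y) = ip y x"
    and ip_positive: "cpositive (ip x x)"
    and norm_eq_ip: "norm x = sqrt (norm (ip x x))"

definition closed_submodule :: "('a \<Rightarrow> 'x \<Rightarrow> 'x) \<Rightarrow> 'x::complex_banach set \<Rightarrow> bool"
  where "closed_submodule act W \<longleftrightarrow> closed W \<and> 0 \<in> W \<and>
    (\<forall>x\<in>W. \<forall>y\<in>W. x + y \<in> W) \<and> (\<forall>c. \<forall>x\<in>W. c *\<^sub>C x \<in> W) \<and> (\<forall>a. \<forall>x\<in>W. act a x \<in> W)"

text \<open>The next two notions take the underlying sets \<open>X\<close>, \<open>Y\<close> as parameters because they are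
  applied to submodules and to sets of families.  On a set of families considered modulo
  a.e. equality, an adjoint is determined only up to a.e. equality.\<close>

definition adjoint_pair ::
  "'x set \<Rightarrow> ('x \<Rightarrow> 'x \<Rightarrow> 'a) \<Rightarrow> 'y set \<Rightarrow> ('y \<Rightarrow> 'y \<Rightarrow> 'a) \<Rightarrow> ('x \<Rightarrow> 'y) \<Rightarrow> ('y \<Rightarrow> 'x) \<Rightarrow> bool"
  where "adjoint_pair X ipX Y ipY L L' \<longleftrightarrow> (\<forall>x\<in>X. L x \<in> Y) \<and> (\<forall>y\<in>Y. L' y \<in> X) \<and>
    (\<forall>x\<in>X. \<forall>y\<in>Y. ipY (L x) y = ipX x (L' y))"

definition adjoint_op ::
  "'x set \<Rightarrow> ('x \<Rightarrow> 'x \<Rightarrow> 'a) \<Rightarrow> 'y set \<Rightarrow> ('y \<Rightarrow> 'y \<Rightarrow> 'a) \<Rightarrow> ('x \<Rightarrow> 'y) \<Rightarrow> 'y \<Rightarrow> 'x"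
  where "adjoint_op X ipX Y ipY L = (SOME L'. adjoint_pair X ipX Y ipY L L')"

definition End_star ::
  "('a \<Rightarrow> 'x::complex_banach \<Rightarrow> 'x) \<Rightarrow> ('x \<Rightarrow> 'x \<Rightarrow> 'a) \<Rightarrow>
   ('a \<Rightarrow> 'y::complex_banach \<Rightarrow> 'y) \<Rightarrow> ('y \<Rightarrow> 'y \<Rightarrow> 'a) \<Rightarrow> 'y set \<Rightarrow> ('x \<Rightarrow> 'y) set"
  where "End_star actX ipX actY ipY Y = {L.
    (\<forall>x y. L (x + y) = L x + L y) \<and> (\<forall>c x. L (c *\<^sub>C x) = c *\<^sub>C L x) \<and>
    (\<forall>a x. L (actX a x) = actY a (L x)) \<and>
    (\<exists>L'. adjoint_pair UNIV ipX Y ipY L L')}"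

section \<open>Strong measurability and the weak integral\<close>

definition strongly_measurable :: "'m measure \<Rightarrow> ('m \<Rightarrow> 'x::complex_banach) \<Rightarrow> bool"
  where "strongly_measurable M f \<longleftrightarrow>
    (\<exists>s. (\<forall>n::nat. simple_function M (s n)) \<and> (AE m in M. (\<lambda>n. s n m) \<longlonglongrightarrow> f m))"

definition functionals :: "('x::complex_banach \<Rightarrow> complex) set"
  where "functionals = {\<phi>. bounded_linear \<phi> \<and> (\<forall>c x. \<phi> (c *\<^sub>C x) = c * \<phi> x)}"

text \<open>The completion makes the integral insensitive to changing the integrand on a null set
  (as strong measurability is) when \<open>M\<close> itself is not complete.\<close>

definition has_weak_integral ::
  "'m measure \<Rightarrow> ('m \<Rightarrow> 'x::complex_banach) \<Rightarrow> 'x \<Rightarrow> bool"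
  where "has_weak_integral M f x \<longleftrightarrow> (\<forall>\<phi>\<in>functionals.
    integrable (completion M) (\<lambda>m. \<phi> (f m)) \<and>
    integral\<^sup>L (completion M) (\<lambda>m. \<phi> (f m)) = \<phi> x)"

definition weak_integral :: "'m measure \<Rightarrow> ('m \<Rightarrow> 'x::complex_banach) \<Rightarrow> 'x"
  where "weak_integral M f = (THE x. has_weak_integral M f x)"

section \<open>The direct sum of a family of submodules\<close>

text \<open>Elements are represented by families; families that agree almost everywhere represent
  the same element.\<close>

definition direct_sum ::
  "'m measure \<Rightarrow> ('v \<Rightarrow> 'v \<Rightarrow> 'a::cstar_algebra) \<Rightarrow> ('m \<Rightarrow> 'v::complex_banach set) \<Rightarrow> ('m \<Rightarrow> 'v) set"
  where "direct_sum M ip V = {g. strongly_measurable M g \<and> (\<forall>m\<in>space M. g m \<in> V m) \<and>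
    (\<exists>a. has_weak_integral M (\<lambda>m. ip (g m) (g m)) a)}"

definition direct_sum_ip ::
  "'m measure \<Rightarrow> ('v \<Rightarrow> 'v \<Rightarrow> 'a::cstar_algebra) \<Rightarrow> ('m \<Rightarrow> 'v) \<Rightarrow> ('m \<Rightarrow> 'v) \<Rightarrow> 'a"
  where "direct_sum_ip M ip f g = weak_integral M (\<lambda>m. ip (f m) (g m))"

definition direct_sum_norm ::
  "'m measure \<Rightarrow> ('v \<Rightarrow> 'v \<Rightarrow> 'a::cstar_algebra) \<Rightarrow> ('m \<Rightarrow> 'v) \<Rightarrow> real"
  where "direct_sum_norm M ip f = sqrt (norm (direct_sum_ip M ip f f))"

text \<open>The direct sum, modulo a.e. equality and with the pointwise operations, is a Hilbert
  module; the existence of all integrals defining the inner product is part of this. The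
  module axioms themselves hold pointwise.\<close>

definition direct_sum_hilbert ::
  "'m measure \<Rightarrow> ('a \<Rightarrow> 'v \<Rightarrow> 'v) \<Rightarrow> ('v \<Rightarrow> 'v \<Rightarrow> 'a::cstar_algebra) \<Rightarrow>
   ('m \<Rightarrow> 'v::complex_banach set) \<Rightarrow> bool"
  where "direct_sum_hilbert M act ip V \<longleftrightarrow>
    (\<forall>f\<in>direct_sum M ip V. \<forall>g\<in>direct_sum M ip V. (\<lambda>m. f m + g m) \<in> direct_sum M ip V) \<and>
    (\<forall>c. \<forall>f\<in>direct_sum M ip V. (\<lambda>m. c *\<^sub>C f m) \<in> direct_sum M ip V) \<and>
    (\<forall>a. \<forall>f\<in>direct_sum M ip V. (\<lambda>m. act a (f m)) \<in> direct_sum M ip V) \<and>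
    (\<forall>f\<in>direct_sum M ip V. \<forall>g\<in>direct_sum M ip V. \<exists>a. has_weak_integral M (\<lambda>m. ip (f m) (g m)) a) \<and>
    (\<forall>f\<in>direct_sum M ip V. \<forall>g\<in>direct_sum M ip V. \<forall>h\<in>direct_sum M ip V.
      direct_sum_ip M ip (\<lambda>m. f m + g m) h = direct_sum_ip M ip f h + direct_sum_ip M ip g h) \<and>
    (\<forall>c. \<forall>f\<in>direct_sum M ip V. \<forall>g\<in>direct_sum M ip V.
      direct_sum_ip M ip (\<lambda>m. c *\<^sub>C f m) g = c *\<^sub>C direct_sum_ip M ip f g) \<and>
    (\<forall>a. \<forall>f\<in>direct_sum M ip V. \<forall>g\<in>direct_sum M ip V.
      direct_sum_ip M ip (\<lambda>m. act a (f m)) g = a * direct_sum_ip M ip f g) \<and>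
    (\<forall>f\<in>direct_sum M ip V. \<forall>g\<in>direct_sum M ip V. star (direct_sum_ip M ip f g) = direct_sum_ip M ip g f) \<and>
    (\<forall>f\<in>direct_sum M ip V. cpositive (direct_sum_ip M ip f f)) \<and>
    (\<forall>f\<in>direct_sum M ip V. direct_sum_ip M ip f f = 0 \<longrightarrow> (AE m in M. f m = 0)) \<and>
    (\<forall>F::nat \<Rightarrow> _. (\<forall>n. F n \<in> direct_sum M ip V) \<and>
        (\<forall>e>0. \<exists>N. \<forall>i\<ge>N. \<forall>j\<ge>N. direct_sum_norm M ip (\<lambda>m. F i m - F j m) < e) \<longrightarrow>
        (\<exists>f\<in>direct_sum M ip V. (\<lambda>n. direct_sum_norm M ip (\<lambda>m. F n m - f m)) \<longlonglongrightarrow> 0))"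

text \<open>Linear maps on the direct sum; the first condition says that the map is well defined on
  classes modulo a.e. equality. The operator norm is the analogue of \<^const>\<open>onorm\<close>.\<close>

definition direct_sum_bounded_linear ::
  "'m measure \<Rightarrow> ('v \<Rightarrow> 'v \<Rightarrow> 'a::cstar_algebra) \<Rightarrow> ('m \<Rightarrow> 'v::complex_banach set) \<Rightarrow>
   (('m \<Rightarrow> 'v) \<Rightarrow> 'u::complex_banach) \<Rightarrow> bool"
  where "direct_sum_bounded_linear M ip V T \<longleftrightarrow>
    (\<forall>f\<in>direct_sum M ip V. \<forall>g\<in>direct_sum M ip V. (AE m in M. f m = g m) \<longrightarrow> T f = T g) \<and>
    (\<forall>f\<in>direct_sum M ip V. \<forall>g\<in>direct_sum M ip V. T (\<lambda>m. f m + g m) = T f + T g) \<and>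
    (\<forall>c. \<forall>f\<in>direct_sum M ip V. T (\<lambda>m. c *\<^sub>C f m) = c *\<^sub>C T f) \<and>
    (\<exists>K. \<forall>f\<in>direct_sum M ip V. norm (T f) \<le> K * direct_sum_norm M ip f)"

definition direct_sum_onorm ::
  "'m measure \<Rightarrow> ('v \<Rightarrow> 'v \<Rightarrow> 'a::cstar_algebra) \<Rightarrow> ('m \<Rightarrow> 'v::complex_banach set) \<Rightarrow>
   (('m \<Rightarrow> 'v) \<Rightarrow> 'u::complex_banach) \<Rightarrow> real"
  where "direct_sum_onorm M ip V T = (SUP f\<in>direct_sum M ip V. norm (T f) / direct_sum_norm M ip f)"

section \<open>Continuous g-Bessel systems\<close>

definition cg_bessel ::
  "'m measure \<Rightarrow> ('a::cstar_algebra \<Rightarrow> 'u::complex_banach \<Rightarrow> 'u) \<Rightarrow> ('u \<Rightarrow> 'u \<Rightarrow> 'a) \<Rightarrow>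
   ('a \<Rightarrow> 'v::complex_banach \<Rightarrow> 'v) \<Rightarrow> ('v \<Rightarrow> 'v \<Rightarrow> 'a) \<Rightarrow> ('m \<Rightarrow> 'v set) \<Rightarrow>
   ('m \<Rightarrow> 'u \<Rightarrow> 'v) \<Rightarrow> real \<Rightarrow> bool"
  where "cg_bessel M actU ipU actV ipV V \<Lambda> B \<longleftrightarrow> 0 < B \<and>
    (\<forall>m\<in>space M. \<Lambda> m \<in> End_star actU ipU actV ipV (V m)) \<and>
    (\<forall>f. strongly_measurable M (\<lambda>m. \<Lambda> m f)) \<and>
    (\<forall>f. \<exists>a. has_weak_integral M (\<lambda>m. ipV (\<Lambda> m f) (\<Lambda> m f)) a \<and> cle a (B *\<^sub>R ipU f f))"

definition cg_frame_operator ::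
  "'m measure \<Rightarrow> ('u \<Rightarrow> 'u \<Rightarrow> 'a::cstar_algebra) \<Rightarrow> ('v \<Rightarrow> 'v \<Rightarrow> 'a) \<Rightarrow> ('m \<Rightarrow> 'v set) \<Rightarrow>
   ('m \<Rightarrow> 'u \<Rightarrow> 'v) \<Rightarrow> ('u \<Rightarrow> 'u) \<Rightarrow> bool"
  where "cg_frame_operator M ipU ipV V \<Lambda> S \<longleftrightarrow>
    (\<forall>f g. has_weak_integral M (\<lambda>m. ipU (adjoint_op UNIV ipU (V m) ipV (\<Lambda> m) (\<Lambda> m f)) g)
      (ipU (S f) g))"

text \<open>\<open>T\<close> is a map into \<open>U\<close> with \<open>\<langle>T f, g\<rangle> = \<integral> \<langle>\<Lambda>\<^sub>m\<^sup>* f\<^sub>m, g\<rangle> d\<mu>(m)\<close>.\<close>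

definition cg_synthesis ::
  "'m measure \<Rightarrow> ('u \<Rightarrow> 'u \<Rightarrow> 'a::cstar_algebra) \<Rightarrow> ('v \<Rightarrow> 'v \<Rightarrow> 'a) \<Rightarrow>
   ('m \<Rightarrow> 'v::complex_banach set) \<Rightarrow> ('m \<Rightarrow> 'u \<Rightarrow> 'v) \<Rightarrow> (('m \<Rightarrow> 'v) \<Rightarrow> 'u) \<Rightarrow> bool"
  where "cg_synthesis M ipU ipV V \<Lambda> T \<longleftrightarrow>
    (\<forall>f\<in>direct_sum M ipV V. \<forall>g.
      has_weak_integral M (\<lambda>m. ipU (adjoint_op UNIV ipU (V m) ipV (\<Lambda> m) (f m)) g) (ipU (T f) g))"

end

theory Submission
  imports Defs
begin

text \<open>Since \<open>\<langle>\<Lambda>\<^sub>m\<^sup>*f\<^sub>m, g\<rangle> = \<langle>f\<^sub>m, \<Lambda>\<^sub>mg\<rangle>\<close>, the defining property of \<open>T\<close> reads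
  \<open>\<langle>Tf, g\<rangle> = \<langle>f, {\<Lambda>\<^sub>mg}\<rangle>\<close>, which gives the adjoint and \<open>S = TT\<^sup>*\<close>. Taking \<open>g = Tf\<close>, the
  Cauchy-Schwarz inequality in the direct sum and the Bessel bound give
  \<open>\<parallel>Tf\<parallel>\<^sup>2 \<le> \<parallel>f\<parallel> \<parallel>{\<Lambda>\<^sub>mTf}\<parallel> \<le> \<parallel>f\<parallel> (sqrt B) \<parallel>Tf\<parallel>\<close>. Weak integrals are unique because functionals
  separate points: a minimal sublinear functional is linear (Hahn-Banach). The two inequalities
  rest on monotonicity of the norm on positive elements of a C*-algebra, hence on the positivity
  of \<open>b\<^sup>*b\<close> (Fukamiya-Kaplansky), which is obtained without spectral theory from the binomial series of
  the square root.\<close>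

section \<open>Functionals separate points\<close>

definition sublinear :: "('a::real_vector \<Rightarrow> real) \<Rightarrow> bool"
  where "sublinear p \<longleftrightarrow> (\<forall>x y. p (x + y) \<le> p x + p y) \<and> (\<forall>t\<ge>0. \<forall>x. p (t *\<^sub>R x) = t * p x)"

text \<open>The inequality for positive factors suffices: applied to \<open>inverse t\<close> and
  \<open>t *\<^sub>R x\<close> it yields the reverse one.\<close>

lemma sublinearI:
  assumes add: "\<And>x y. p (x + y) \<le> p x + p y"
    and zero: "p 0 = 0"
    and scale: "\<And>t x. t > 0 \<Longrightarrow> p (t *\<^sub>R x) \<le> t * p x"
  shows "sublinear p"
proof -
  have "p (t *\<^sub>R x) = t * p x" if "t \<ge> 0" for t x
  proof (cases "t = 0")
    case False
    with that have t: "t > 0" by simp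
    have "p x \<le> inverse t * p (t *\<^sub>R x)"
      using scale[of "inverse t" "t *\<^sub>R x"] t by simp
    then have "t * p x \<le> p (t *\<^sub>R x)" using t by (simp add: field_simps)
    with scale[OF t, of x] show ?thesis by simp
  qed (simp add: zero)
  then show ?thesis using add by (auto simp: sublinear_def)
qed

lemma sublinear_add: "sublinear p \<Longrightarrow> p (x + y) \<le> p x + p y"
  by (simp add: sublinear_def)

lemma sublinear_scale: "sublinear p \<Longrightarrow> t \<ge> 0 \<Longrightarrow> p (t *\<^sub>R x) = t * p x"
  by (simp add: sublinear_def)

lemma sublinear_zero: "sublinear p \<Longrightarrow> p 0 = 0"
  using sublinear_scale[of p 0 0] by simp

lemma sublinear_minus: "sublinear p \<Longrightarrow> - p (- x) \<le> p x"
  using sublinear_add[of p x "- x"] by (simp add: sublinear_zero)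

text \<open>Zorn's lemma for the reversed pointwise order on the sublinear functionals below
  \<open>p\<close>; the pointwise infimum of a nonempty chain is again sublinear.\<close>

lemma minimal_sublinear:
  assumes p: "sublinear (p :: 'a::real_vector \<Rightarrow> real)"
  obtains f where "sublinear f" "f \<le> p" "\<And>q. sublinear q \<Longrightarrow> q \<le> f \<Longrightarrow> q = f"
proof -
  define A where "A = {q. sublinear q \<and> q \<le> p}"
  have "\<exists>m\<in>A. \<forall>a\<in>A. a \<le> m \<longrightarrow> a = m"
  proof (rule predicate_Zorn)
    show "partial_order_on A (relation_of (\<lambda>f g. g \<le> f) A)"
      by (rule partial_order_on_relation_ofI) auto
  next
    fix C assume C: "C \<in> Chains (relation_of (\<lambda>f g. g \<le> f) A)"
    then have CA: "C \<subseteq> A" and chain: "\<And>f g. f \<in> C \<Longrightarrow> g \<in> C \<Longrightarrow> f \<le> g \<or> g \<le> f"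
      unfolding Chains_def relation_of_def by auto
    show "\<exists>u\<in>A. \<forall>a\<in>C. u \<le> a"
    proof (cases "C = {}")
      case True
      then show ?thesis using p by (auto simp: A_def)
    next
      case False
      define u where "u x = (INF q\<in>C. q x)" for x
      \<comment> \<open>A lower bound independent of \<open>q\<close>, so that the infimum over the
        chain is finite.\<close>
      have lower: "- p (- x) \<le> q x" if "q \<in> C" for q x
      proof -
        have "sublinear q" "q (- x) \<le> p (- x)" using that CA by (auto simp: A_def le_fun_def)
        then show ?thesis using sublinear_minus[of q x] by simp
      qed
      then have bdd: "bdd_below ((\<lambda>q. q x) ` C)" for x
        by (auto intro!: bdd_belowI2)
      have u_le: "u x \<le> q x" if "q \<in> C" for q x
        unfolding u_def by (rule cINF_lower[OF bdd that])
      have sl: "sublinear q" if "q \<in> C" for q using that CA by (auto simp: A_def)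
      have "sublinear u"
      proof (rule sublinearI)
        fix x y
        \<comment> \<open>The two members of the chain may differ; the smaller one, being
          subadditive, serves for both arguments.\<close>
        have "u (x + y) \<le> q1 x + q2 y" if q: "q1 \<in> C" "q2 \<in> C" for q1 q2
          using chain[OF q]
        proof
          assume "q1 \<le> q2"
          then show ?thesis
            using u_le[OF q(1), of "x + y"] sublinear_add[OF sl[OF q(1)], of x y] le_funD[of q1 q2 y]
            by linarith
        next
          assume "q2 \<le> q1"
          then show ?thesis
            using u_le[OF q(2), of "x + y"] sublinear_add[OF sl[OF q(2)], of x y] le_funD[of q2 q1 x]
            by linarith
        qed
        then have "u (x + y) - q1 x \<le> q2 y" if "q1 \<in> C" "q2 \<in> C" for q1 q2
          using that by (simp add: diff_le_eq add.commute)
        then have "u (x + y) - q1 x \<le> u y" if "q1 \<in> C" for q1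
          unfolding u_def[of y] using that False by (intro cINF_greatest)
        then have "u (x + y) - u y \<le> q1 x" if "q1 \<in> C" for q1
          using that by (simp add: diff_le_eq add.commute)
        then have "u (x + y) - u y \<le> u x"
          unfolding u_def[of x] using False by (intro cINF_greatest)
        then show "u (x + y) \<le> u x + u y" by simp
      next
        have "(\<lambda>q. q 0) ` C = {0}" using False sublinear_zero[OF sl] by force
        then show "u 0 = 0" by (simp add: u_def)
      next
        fix t :: real and x assume t: "t > 0"
        have "u (t *\<^sub>R x) / t \<le> u x"
          unfolding u_def[of x]
        proof (rule cINF_greatest[OF False])
          fix q assume "q \<in> C"
          then show "u (t *\<^sub>R x) / t \<le> q x"
            using u_le[of q "t *\<^sub>R x"] sublinear_scale[OF sl, of q t x] t by (simp add: field_simps)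
        qed
        then show "u (t *\<^sub>R x) \<le> t * u x" using t by (simp add: field_simps)
      qed
      moreover have "u \<le> p"
      proof -
        obtain q where "q \<in> C" using False by blast
        then show ?thesis using u_le[of q] CA by (force simp: A_def le_fun_def intro: order_trans)
      qed
      ultimately show ?thesis using u_le by (auto simp: A_def le_fun_def)
    qed
  qed
  then obtain m where "m \<in> A" "\<And>a. a \<in> A \<Longrightarrow> a \<le> m \<Longrightarrow> a = m" by blast
  then show ?thesis using that[of m] by (auto simp: A_def intro: order_trans)
qed

text \<open>One descent step of Hahn-Banach: in the infimum, \<open>t = 0\<close> gives
  \<open>r \<le> q\<close>, and \<open>t = 1\<close> at \<open>- y\<close> gives the last bound. It
  serves twice: to show that minimal functionals are odd, and to find a norming functional.\<close>

lemma sublinear_below: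
  fixes q :: "'a::real_vector \<Rightarrow> real"
  assumes q: "sublinear q"
  obtains r where "sublinear r" "r \<le> q" "r (- y) \<le> - q y"
proof -
  define r where "r x = (INF t\<in>{0..}. q (x + t *\<^sub>R y) - t * q y)" for x
  have bdd: "bdd_below ((\<lambda>t. q (x + t *\<^sub>R y) - t * q y) ` {0..})" for x
  proof (rule bdd_belowI2)
    fix t :: real assume "t \<in> {0..}"
    then show "- q (- x) \<le> q (x + t *\<^sub>R y) - t * q y"
      using sublinear_add[OF q, of "x + t *\<^sub>R y" "- x"] sublinear_scale[OF q, of t y] by simp
  qed
  have r_le: "r x \<le> q (x + t *\<^sub>R y) - t * q y" if "t \<ge> 0" for t x
    unfolding r_def by (rule cINF_lower[OF bdd]) (use that in simp)
  have r_ge: "b \<le> r x" if "\<And>t. t \<ge> 0 \<Longrightarrow> b \<le> q (x + t *\<^sub>R y) - t * q y" for b x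
    unfolding r_def by (rule cINF_greatest) (use that in auto)
  have "sublinear r"
  proof (rule sublinearI)
    fix x z
    have "r (x + z) \<le> (q (x + s *\<^sub>R y) - s * q y) + (q (z + t *\<^sub>R y) - t * q y)"
      if "s \<ge> 0" "t \<ge> 0" for s t
    proof -
      have "q ((x + z) + (s + t) *\<^sub>R y) \<le> q (x + s *\<^sub>R y) + q (z + t *\<^sub>R y)"
        using sublinear_add[OF q, of "x + s *\<^sub>R y" "z + t *\<^sub>R y"] by (simp add: algebra_simps)
      then show ?thesis using r_le[of "s + t" "x + z"] that by (simp add: algebra_simps)
    qed
    then have "r (x + z) - (q (x + s *\<^sub>R y) - s * q y) \<le> r z" if "s \<ge> 0" for s
      using that by (intro r_ge) (simp add: diff_le_eq add.commute)
    then have "r (x + z) - r z \<le> r x"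
      by (intro r_ge) (smt (verit))
    then show "r (x + z) \<le> r x + r z" by simp
  next
    show "r 0 = 0"
      using r_le[of 0 0] r_ge[of 0 0] by (auto simp: sublinear_scale[OF q] sublinear_zero[OF q])
  next
    fix s :: real and x assume s: "s > 0"
    have "r (s *\<^sub>R x) / s \<le> r x"
    proof (rule r_ge)
      fix t :: real assume t: "t \<ge> 0"
      have "q (s *\<^sub>R x + (s * t) *\<^sub>R y) = s * q (x + t *\<^sub>R y)"
        using sublinear_scale[OF q, of s "x + t *\<^sub>R y"] s by (simp add: algebra_simps)
      then show "r (s *\<^sub>R x) / s \<le> q (x + t *\<^sub>R y) - t * q y"
        using r_le[of "s * t" "s *\<^sub>R x"] s t by (simp add: field_simps)
    qed
    then show "r (s *\<^sub>R x) \<le> s * r x" using s by (simp add: field_simps)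
  qed
  moreover have "r \<le> q" using r_le[of 0] by (auto simp: le_fun_def)
  moreover have "r (- y) \<le> - q y" using r_le[of 1 "- y"] by (simp add: sublinear_zero[OF q])
  ultimately show ?thesis using that by blast
qed

text \<open>By minimality the descent of \<open>sublinear_below\<close> stays at \<open>f\<close>,
  so \<open>f (- y) \<le> - f y\<close>; an odd sublinear functional is linear.\<close>

lemma minimal_sublinear_linear:
  assumes f: "sublinear f" and min: "\<And>q. sublinear q \<Longrightarrow> q \<le> f \<Longrightarrow> q = f"
  shows "linear f"
proof -
  have neg: "f (- y) = - f y" for y
  proof -
    obtain r where "sublinear r" "r \<le> f" "r (- y) \<le> - f y" using sublinear_below[OF f] .
    with min have "f (- y) \<le> - f y" by metis
    with sublinear_minus[OF f, of y] show ?thesis by simp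
  qed
  show ?thesis
  proof (rule linearI)
    fix x y
    show "f (x + y) = f x + f y"
      using sublinear_add[OF f, of x y] sublinear_add[OF f, of "-x" "-y"] neg[of "x + y"]
      by (simp add: neg)
  next
    fix c :: real and x
    show "f (c *\<^sub>R x) = c *\<^sub>R f x"
      using sublinear_scale[OF f, of c x] sublinear_scale[OF f, of "-c" x] neg[of "c *\<^sub>R x"]
      by (cases "c \<ge> 0") auto
  qed
qed

text \<open>The descent starts at the norm, in direction \<open>y\<close>. A minimal functional
  below the result is linear and inherits \<open>f x \<le> norm x\<close> and
  \<open>f (- y) \<le> - norm y\<close>.\<close>

lemma Hahn_Banach_norm:
  fixes y :: "'a::real_normed_vector"
  obtains f where "linear f" "\<And>x. \<bar>f x\<bar> \<le> norm x" "f y = norm y"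
proof -
  have "sublinear (norm :: 'a \<Rightarrow> real)" by (auto simp: sublinear_def norm_triangle_ineq)
  then obtain r where r: "sublinear r" "r \<le> norm" "r (- y) \<le> - norm y"
    using sublinear_below by blast
  obtain f where f: "sublinear f" "f \<le> r" "\<And>q. sublinear q \<Longrightarrow> q \<le> f \<Longrightarrow> q = f"
    using minimal_sublinear[OF r(1)] by metis
  have lin: "linear f" using minimal_sublinear_linear[OF f(1,3)] .
  have le: "f x \<le> norm x" for x
    using f(2) r(2) by (meson le_funD order_trans)
  have "\<bar>f x\<bar> \<le> norm x" for x
    using le[of x] le[of "- x"] by (simp add: linear_neg[OF lin] abs_le_iff)
  moreover have "f (- y) \<le> - norm y" using f(2) r(3) by (meson le_funD order_trans)
  then have "f y = norm y" using le[of y] by (simp add: linear_neg[OF lin])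
  ultimately show ?thesis using lin that by blast
qed

text \<open>It suffices to test with the complexification of a real norming functional of
  \<open>x - y\<close>.\<close>

lemma functionals_separate:
  fixes x y :: "'a::complex_banach"
  assumes eq: "\<And>\<phi>. \<phi> \<in> functionals \<Longrightarrow> \<phi> x = \<phi> y"
  shows "x = y"
proof -
  obtain f where lin: "linear f" and le: "\<And>z. \<bar>f z\<bar> \<le> norm z" and f: "f (x - y) = norm (x - y)"
    using Hahn_Banach_norm[of "x - y"] by blast
  \<comment> \<open>This is f(z) - i f(iz), which is complex linear with real part
    \<open>f\<close>.\<close>
  define \<phi> where "\<phi> z = Complex (f z) (- f (\<i> *\<^sub>C z))" for z
  have fC: "f (c *\<^sub>C z) = Re c * f z + Im c * f (\<i> *\<^sub>C z)" for c z
  proof -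
    have "c *\<^sub>C z = (complex_of_real (Re c) + complex_of_real (Im c) * \<i>) *\<^sub>C z"
      by (metis complex_eq mult.commute)
    also have "\<dots> = Re c *\<^sub>R z + Im c *\<^sub>R (\<i> *\<^sub>C z)"
      by (simp only: scaleC_add_left scaleC_of_real flip: scaleC_scaleC)
    finally show ?thesis by (simp add: linear_add[OF lin] linear_scale[OF lin])
  qed
  have add: "\<phi> (z + w) = \<phi> z + \<phi> w" for z w
    by (simp add: \<phi>_def scaleC_add_right linear_add[OF lin] complex_eq_iff)
  have scale: "\<phi> (c *\<^sub>C z) = c * \<phi> z" for c z
    using fC[of c z] fC[of "\<i> * c" z] by (simp add: \<phi>_def scaleC_scaleC complex_eq_iff)
  have "bounded_linear \<phi>"
  proof (rule bounded_linear_intro[where K=2])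
    show "\<phi> (r *\<^sub>R z) = r *\<^sub>R \<phi> z" for r z
      using scale[of "complex_of_real r" z] by (simp add: scaleC_of_real scaleR_conv_of_real)
    show "norm (\<phi> z) \<le> norm z * 2" for z
      using le[of z] le[of "\<i> *\<^sub>C z"] cmod_le[of "\<phi> z"] by (simp add: \<phi>_def norm_scaleC)
  qed (rule add)
  then have "\<phi> \<in> functionals" by (simp add: functionals_def scale)
  then have "Re (\<phi> x) = Re (\<phi> y)" using eq[of \<phi>] by simp
  then have "norm (x - y) = 0" using f by (simp add: \<phi>_def linear_diff[OF lin])
  then show ?thesis by simp
qed

section \<open>Uniqueness of weak integrals\<close>

lemma has_weak_integral_unique:
  "has_weak_integral M f x \<Longrightarrow> has_weak_integral M f y \<Longrightarrow> x = y"
  by (rule functionals_separate) (metis has_weak_integral_def)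

lemma weak_integral_eq: "has_weak_integral M f x \<Longrightarrow> weak_integral M f = x"
  unfolding weak_integral_def by (blast intro: has_weak_integral_unique)

lemma has_weak_integral_cong:
  assumes "\<And>m. m \<in> space M \<Longrightarrow> f m = g m"
  shows "has_weak_integral M f x \<longleftrightarrow> has_weak_integral M g x"
proof -
  have "integrable (completion M) (\<lambda>m. \<phi> (f m)) = integrable (completion M) (\<lambda>m. \<phi> (g m))"
    "integral\<^sup>L (completion M) (\<lambda>m. \<phi> (f m)) = integral\<^sup>L (completion M) (\<lambda>m. \<phi> (g m))"
    for \<phi> :: "'b \<Rightarrow> complex"
    using assms by (auto intro!: Bochner_Integration.integrable_cong Bochner_Integration.integral_cong)
  then show ?thesis by (simp add: has_weak_integral_def)
qed

text \<open>Used to show that \<open>T\<close> is well defined on classes modulo a.e. equality. The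
  measurability needed for comparing the integrals comes from integrability on the
  completion.\<close>

lemma has_weak_integral_unique_AE:
  assumes f: "has_weak_integral M f x" and g: "has_weak_integral M g y"
    and ae: "AE m in M. f m = g m"
  shows "x = y"
proof (rule functionals_separate)
  fix \<phi> :: "'b \<Rightarrow> complex" assume \<phi>: "\<phi> \<in> functionals"
  have "AE m in completion M. \<phi> (f m) = \<phi> (g m)"
    using AE_completion[OF ae] by auto
  then have "integral\<^sup>L (completion M) (\<lambda>m. \<phi> (f m)) = integral\<^sup>L (completion M) (\<lambda>m. \<phi> (g m))"
    using f g \<phi> by (intro integral_cong_AE) (auto simp: has_weak_integral_def)
  then show "\<phi> x = \<phi> y" using f g \<phi> by (simp add: has_weak_integral_def)
qed

section \<open>The involution\<close>

lemma scaleC_zero_left [simp]: "0 *\<^sub>C x = (0::'a::complex_banach)"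
  using scaleC_of_real[of 0 x] by simp

lemma scaleC_one [simp]: "1 *\<^sub>C x = (x::'a::complex_banach)"
  using scaleC_of_real[of 1 x] by simp

lemma scaleC_minus_left [simp]: "(- c) *\<^sub>C x = - (c *\<^sub>C (x::'a::complex_banach))"
  using scaleC_add_left[of c "- c" x] by (simp add: eq_neg_iff_add_eq_0 add.commute)

lemma scaleC_zero_right [simp]: "c *\<^sub>C (0::'a::complex_banach) = 0"
  using scaleC_add_right[of c "0::'a" 0] by simp

lemma scaleC_minus_right [simp]: "c *\<^sub>C (- x) = - (c *\<^sub>C (x::'a::complex_banach))"
  using scaleC_add_right[of c x "- x"] by (simp add: eq_neg_iff_add_eq_0 add.commute)

lemma scaleC_diff_right: "c *\<^sub>C (x - y) = c *\<^sub>C x - c *\<^sub>C (y::'a::complex_banach)"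
  using scaleC_add_right[of c x "- y"] by simp

lemma star_scaleR: "star (r *\<^sub>R a) = r *\<^sub>R star (a::'a::cstar_algebra)"
  by (simp add: star_scaleC flip: scaleC_of_real)

lemma star_zero [simp]: "star (0::'a::cstar_algebra) = 0"
  using star_scaleR[of 0 "0::'a"] by simp

lemma star_minus: "star (- a) = - star (a::'a::cstar_algebra)"
  using star_scaleR[of "-1" a] by simp

lemma star_diff: "star (a - b) = star a - star (b::'a::cstar_algebra)"
  using star_add[of a "-b"] by (simp add: star_minus)

text \<open>The C*-identity gives \<open>norm b \<le> norm (star b)\<close>, to be applied to
  \<open>a\<close> and to \<open>star a\<close>.\<close>

lemma norm_star: "norm (star a) = norm (a::'a::cstar_algebra)"
proof -
  have le: "norm b \<le> norm (star b)" for b :: 'a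
  proof (cases "b = 0")
    case False
    have "norm b * norm b \<le> norm (star b) * norm b"
      using norm_star_mult[of b] norm_mult_ineq[of "star b" b] by (simp add: power2_eq_square)
    with False show ?thesis by simp
  qed simp
  show ?thesis using le[of a] le[of "star a"] by (simp add: star_star)
qed

lemma bounded_linear_star: "bounded_linear (star :: 'a::cstar_algebra \<Rightarrow> 'a)"
  by (rule bounded_linear_intro[where K=1]) (auto simp: star_add star_scaleR norm_star)

lemma norm_square_selfadjoint: "star a = a \<Longrightarrow> norm (a * a) = (norm (a::'a::cstar_algebra))\<^sup>2"
  using norm_star_mult[of a] by simp

lemma star_one [simp]: "star (1::'a::{cstar_algebra,monoid_mult}) = 1"
  by (metis mult.right_neutral star_mult star_star)

text \<open>The norm of 1 equals its own square, so it is 0 or 1; the value 0 occurs in the zero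
  algebra, which \<open>monoid_mult\<close> admits.\<close>

lemma norm_one_le: "norm (1::'a::{cstar_algebra,monoid_mult}) \<le> 1"
proof -
  have "norm (1::'a) * norm (1::'a) = 1 * norm (1::'a)"
    using norm_square_selfadjoint[of "1::'a"] by (simp add: power2_eq_square)
  then show ?thesis by (metis mult_right_cancel order_refl zero_le_one)
qed

section \<open>Square roots\<close>

text \<open>The Taylor coefficients of \<open>sqrt (1 - x)\<close> at 0.\<close>

definition sqrt_coeff :: "nat \<Rightarrow> real"
  where "sqrt_coeff n = ((1/2) gchoose n) * (-1) ^ n"

lemma sqrt_coeff_0 [simp]: "sqrt_coeff 0 = 1"
  by (simp add: sqrt_coeff_def)

text \<open>Written with \<open>pochhammer (-1/2)\<close>, the coefficient has exactly one negative
  factor.\<close>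

lemma sqrt_coeff_Suc_nonpos: "sqrt_coeff (Suc n) \<le> 0"
proof -
  have "sqrt_coeff (Suc n) = pochhammer (-1/2) (Suc n) / fact (Suc n)"
    by (simp add: sqrt_coeff_def gbinomial_pochhammer flip: power_mult_distrib)
  also have "pochhammer (-1/2::real) (Suc n) = (-1/2) * pochhammer (1/2) n"
    by (simp add: pochhammer_rec)
  finally show ?thesis
    by (simp add: pochhammer_nonneg mult_nonneg_nonneg del: fact_Suc)
qed

text \<open>The partial sums of the coefficients of \<open>sqrt (1 - x)\<close> are the coefficients
  of \<open>1 / sqrt (1 - x)\<close>.\<close>

lemma sum_sqrt_coeff_nonneg: "0 \<le> (\<Sum>k\<le>n. sqrt_coeff k)"
proof -
  have "(\<Sum>k\<le>n. sqrt_coeff k) = (-1) ^ n * ((-1/2) gchoose n)"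
    unfolding sqrt_coeff_def gbinomial_sum_lower_neg by simp
  also have "\<dots> = pochhammer (1/2) n / fact n"
    by (simp add: gbinomial_pochhammer flip: power_mult_distrib)
  finally show ?thesis by (simp add: pochhammer_nonneg)
qed

text \<open>The terms after the leading 1 are nonpositive while the partial sums stay nonnegative.
  Hence the series converges absolutely even at norm 1.\<close>

lemma sqrt_coeff_abs_partial: "(\<Sum>k<n. \<bar>sqrt_coeff (Suc k)\<bar>) \<le> 1"
proof -
  have "(\<Sum>k<n. \<bar>sqrt_coeff (Suc k)\<bar>) = - (\<Sum>k<n. sqrt_coeff (Suc k))"
    by (simp add: sum_negf[symmetric] abs_of_nonpos sqrt_coeff_Suc_nonpos)
  moreover have "(\<Sum>k\<le>n. sqrt_coeff k) = 1 + (\<Sum>k<n. sqrt_coeff (Suc k))"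
    by (simp only: lessThan_Suc_atMost[symmetric] sum.lessThan_Suc_shift sqrt_coeff_0)
  ultimately show ?thesis using sum_sqrt_coeff_nonneg[of n] by simp
qed

lemma summable_sqrt_coeff_Suc: "summable (\<lambda>n. \<bar>sqrt_coeff (Suc n)\<bar>)"
  by (rule summableI_nonneg_bounded[OF _ sqrt_coeff_abs_partial]) simp

text \<open>Vandermonde's identity with \<open>1/2 + 1/2 = 1\<close>: the series squares to
  \<open>1 - x\<close>.\<close>

lemma sqrt_coeff_convolution:
  "(\<Sum>k\<le>n. sqrt_coeff k * sqrt_coeff (n - k)) = (if n = 0 then 1 else if n = 1 then -1 else 0)"
proof -
  have "(\<Sum>k\<le>n. sqrt_coeff k * sqrt_coeff (n - k))
      = (\<Sum>k\<le>n. ((1/2) gchoose k) * ((1/2) gchoose (n - k)) * (-1) ^ n)"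
    by (rule sum.cong) (auto simp: sqrt_coeff_def simp flip: power_add)
  also have "\<dots> = ((1::real) gchoose n) * (-1) ^ n"
    unfolding sum_distrib_right[symmetric] atMost_atLeast0 gbinomial_Vandermonde by simp
  also have "(1::real) gchoose n = of_nat (1 choose n)"
    using binomial_gbinomial[of 1 n, where 'a=real] by simp
  also have "of_nat (1 choose n) * (-1) ^ n = (if n = 0 then 1 else if n = 1 then -1 else (0::real))"
    by (auto simp: binomial_eq_0)
  finally show ?thesis .
qed

text \<open>The binomial series gives \<open>k\<close>. As a limit of real polynomials in
  \<open>x\<close> it is self-adjoint and commutes with whatever commutes with \<open>x\<close>; the
  bound on \<open>1 - k\<close>, the sum of the nonconstant terms, later makes the root
  positive.\<close>

lemma sqrt_one_minus:
  fixes x :: "'a::{cstar_algebra,monoid_mult}"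
  assumes sa: "star x = x" and le1: "norm x \<le> 1"
  obtains k where "star k = k" "k * k = 1 - x" "norm (1 - k) \<le> 1"
    "\<And>y. y * x = x * y \<Longrightarrow> y * k = k * y"
proof -
  define f where "f n = sqrt_coeff n *\<^sub>R x ^ n" for n
  have pow: "norm (x ^ n) \<le> 1" for n
  proof (induction n)
    case (Suc n)
    have "norm (x * x ^ n) \<le> norm x * norm (x ^ n)" by (rule norm_mult_ineq)
    also have "\<dots> \<le> 1" using Suc le1 by (simp add: mult_le_one)
    finally show ?case by simp
  qed (simp add: norm_one_le)
  have starpow: "star (x ^ n) = x ^ n" for n
    by (induction n) (simp_all add: star_mult sa power_commutes)
  have nf: "norm (f (Suc n)) \<le> \<bar>sqrt_coeff (Suc n)\<bar>" for n
    using mult_left_mono[OF pow[of "Suc n"], of "\<bar>sqrt_coeff (Suc n)\<bar>"] by (simp add: f_def)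
  have sumSuc: "summable (\<lambda>n. norm (f (Suc n)))"
    by (rule summable_comparison_test'[OF summable_sqrt_coeff_Suc]) (simp add: nf)
  then have nsum: "summable (\<lambda>n. norm (f n))"
    by (simp only: summable_Suc_iff[of "\<lambda>n. norm (f n)"])
  have fsum: "summable f" using nsum by (rule summable_norm_cancel)
  define k where "k = suminf f"
  have "star k = k"
    unfolding k_def bounded_linear.suminf[OF bounded_linear_star fsum]
    unfolding f_def by (simp add: star_scaleR starpow)
  moreover have "k * k = 1 - x"
  proof -
    have conv: "(\<Sum>i\<le>n. f i * f (n - i)) = (if n = 0 then 1 else if n = 1 then - x else 0)" for n
    proof -
      have "(\<Sum>i\<le>n. f i * f (n - i)) = (\<Sum>i\<le>n. (sqrt_coeff i * sqrt_coeff (n - i)) *\<^sub>R x ^ n)"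
        by (rule sum.cong) (auto simp: f_def simp flip: power_add)
      also have "\<dots> = (if n = 0 then 1 else if n = 1 then - x else 0)"
        unfolding scaleR_left.sum[symmetric] sqrt_coeff_convolution by auto
      finally show ?thesis .
    qed
    have "k * k = (\<Sum>n. if n = 0 then 1 else if n = 1 then - x else 0)"
      unfolding k_def Cauchy_product[OF nsum nsum] conv ..
    also have "\<dots> = (\<Sum>n\<in>{0,1::nat}. if n = 0 then 1 else if n = 1 then - x else 0)"
      by (rule suminf_finite) auto
    also have "\<dots> = 1 - x" by simp
    finally show ?thesis .
  qed
  moreover have "norm (1 - k) \<le> 1"
  proof -
    have "k = 1 + (\<Sum>n. f (Suc n))"
      unfolding k_def suminf_split_head[OF fsum] by (simp add: f_def)
    then have "norm (1 - k) = norm (\<Sum>n. f (Suc n))" by simp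
    also have "\<dots> \<le> (\<Sum>n. norm (f (Suc n)))" by (rule summable_norm[OF sumSuc])
    also have "\<dots> \<le> (\<Sum>n. \<bar>sqrt_coeff (Suc n)\<bar>)"
      by (rule suminf_le[OF nf sumSuc summable_sqrt_coeff_Suc])
    also have "\<dots> \<le> 1"
      by (rule suminf_le_const[OF summable_sqrt_coeff_Suc sqrt_coeff_abs_partial])
    finally show ?thesis .
  qed
  moreover have "y * k = k * y" if "y * x = x * y" for y
  proof -
    have "y * x ^ n = x ^ n * y" for n
      using that by (induction n) (simp_all, metis mult.assoc)
    then show ?thesis
      unfolding k_def suminf_mult[OF fsum, symmetric] suminf_mult2[OF fsum]
      by (simp add: f_def)
  qed
  ultimately show ?thesis using that by blast
qed

section \<open>Positive elements of a unital C*-algebra\<close>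

text \<open>A norm characterisation of self-adjoint elements with nonnegative spectrum; unlike
  \<^const>\<open>cpositive\<close> it is visibly closed under addition.\<close>

definition spos :: "'a::{cstar_algebra,monoid_mult} \<Rightarrow> bool"
  where "spos h \<longleftrightarrow> star h = h \<and> (\<exists>t\<ge>0. norm (t *\<^sub>R 1 - h) \<le> t)"

lemma spos_selfadjoint: "spos h \<Longrightarrow> star h = h"
  by (simp add: spos_def)

lemma spos_add:
  assumes "spos a" "spos b"
  shows "spos (a + b)"
proof -
  obtain s t where "s \<ge> 0" "norm (s *\<^sub>R 1 - a) \<le> s" "t \<ge> 0" "norm (t *\<^sub>R 1 - b) \<le> t"
    using assms by (auto simp: spos_def)
  moreover have "(s + t) *\<^sub>R 1 - (a + b) = (s *\<^sub>R 1 - a) + (t *\<^sub>R 1 - b)"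
    by (simp add: algebra_simps)
  ultimately have "norm ((s + t) *\<^sub>R 1 - (a + b)) \<le> s + t"
    by (metis add_mono norm_triangle_ineq order_trans)
  with \<open>s \<ge> 0\<close> \<open>t \<ge> 0\<close> show ?thesis
    using assms by (auto simp: spos_def star_add intro!: exI[of _ "s + t"])
qed

lemma spos_scaleR:
  assumes "r \<ge> 0" "spos a"
  shows "spos (r *\<^sub>R a)"
proof -
  obtain t where t: "t \<ge> 0" "norm (t *\<^sub>R 1 - a) \<le> t" and a: "star a = a"
    using assms by (auto simp: spos_def)
  have "(r * t) *\<^sub>R 1 - r *\<^sub>R a = r *\<^sub>R (t *\<^sub>R 1 - a)" by (simp add: algebra_simps)
  then have "norm ((r * t) *\<^sub>R 1 - r *\<^sub>R a) \<le> r * t"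
    using t(2) assms(1) by (simp add: mult_left_mono)
  then show ?thesis
    using a t(1) assms(1) by (auto simp: spos_def star_scaleR intro!: exI[of _ "r * t"])
qed

lemma spos_norm_minus:
  assumes "star a = a" "norm a \<le> s"
  shows "spos (s *\<^sub>R 1 - a)"
proof -
  have "0 \<le> s" using assms(2) norm_ge_zero order_trans by blast
  then show ?thesis
    using assms by (auto simp: spos_def star_diff star_scaleR intro!: exI[of _ s])
qed

text \<open>Rescaling reduces this to the series: for \<open>t > 0\<close>, \<open>h\<close> is
  \<open>t\<close> times \<open>1 - x\<close> with \<open>norm x \<le> 1\<close>, and the root is
  \<open>sqrt t\<close> times that of \<open>1 - x\<close>.\<close>

lemma spos_sqrt:
  assumes "spos h"
  obtains k where "spos k" "k * k = h" "\<And>y. y * h = h * y \<Longrightarrow> y * k = k * y"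
proof -
  obtain t where t: "t \<ge> 0" "norm (t *\<^sub>R 1 - h) \<le> t" and h: "star h = h"
    using assms by (auto simp: spos_def)
  show ?thesis
  proof (cases "t = 0")
    case True
    then have "h = 0" using t by simp
    moreover have "spos (0::'a)" by (auto simp: spos_def intro!: exI[of _ 0])
    ultimately show ?thesis using that[of 0] by simp
  next
    case False
    with t have tpos: "t > 0" by simp
    define x where "x = 1 - h /\<^sub>R t"
    have tx: "t *\<^sub>R 1 - h = t *\<^sub>R x" using tpos by (simp add: x_def algebra_simps)
    have "star x = x" by (simp add: x_def star_diff star_scaleR h)
    moreover have "norm x \<le> 1" using t tpos unfolding tx by simp
    ultimately obtain k where k: "star k = k" "k * k = 1 - x" "norm (1 - k) \<le> 1"
      "\<And>y. y * x = x * y \<Longrightarrow> y * k = k * y"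
      using sqrt_one_minus by blast
    have "sqrt t *\<^sub>R 1 - sqrt t *\<^sub>R k = sqrt t *\<^sub>R (1 - k)" by (simp add: algebra_simps)
    then have "norm (sqrt t *\<^sub>R 1 - sqrt t *\<^sub>R k) \<le> sqrt t"
      using k(3) tpos by (simp add: mult_left_le)
    then have "spos (sqrt t *\<^sub>R k)"
      using tpos k(1) by (auto simp: spos_def star_scaleR intro!: exI[of _ "sqrt t"])
    moreover have "(sqrt t *\<^sub>R k) * (sqrt t *\<^sub>R k) = h"
      using tpos by (simp add: k(2) x_def flip: mult.assoc)
    moreover have "y * (sqrt t *\<^sub>R k) = (sqrt t *\<^sub>R k) * y" if "y * h = h * y" for y
    proof -
      have "y * x = x * y" using that by (simp add: x_def algebra_simps)
      then show ?thesis using k(4) by simp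
    qed
    ultimately show ?thesis using that by blast
  qed
qed

text \<open>The element \<open>u = a + ib\<close> satisfies \<open>u\<^sup>*u = a\<^sup>2 + b\<^sup>2\<close>, and \<open>a\<close> is its real part.\<close>

lemma norm_square_le_sum_squares:
  fixes a b :: "'a::cstar_algebra"
  assumes a: "star a = a" and b: "star b = b" and comm: "a * b = b * a"
  shows "(norm a)\<^sup>2 \<le> norm (a * a + b * b)"
proof -
  define u where "u = a + \<i> *\<^sub>C b"
  have su: "star u = a - \<i> *\<^sub>C b"
    by (simp add: u_def star_add star_scaleC a b)
  have "star u * u = a * a + b * b"
    unfolding su by (simp add: u_def algebra_simps mult_scaleC_left mult_scaleC_right
        scaleC_scaleC scaleC_add_right diff_conv_add_uminus comm del: add_uminus_conv_diff)
  then have uu: "norm (a * a + b * b) = (norm u)\<^sup>2"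
    using norm_star_mult[of u] by simp
  have "u + star u = 2 *\<^sub>R a"
    unfolding su by (simp add: u_def scaleR_2)
  then have "2 * norm a \<le> 2 * norm u"
    using norm_triangle_ineq[of u "star u"] by (simp add: norm_star)
  then show ?thesis unfolding uu by simp
qed

text \<open>After normalising \<open>c\<close> to \<open>d\<close> of norm 1, a root
  \<open>w\<close> of \<open>1 - d * d\<close> commutes with \<open>d\<close>. Then
  \<open>norm_square_le_sum_squares\<close> gives \<open>(norm w)\<^sup>2 \<le> 1\<close>, that is
  \<open>norm (1 - d * d) \<le> 1\<close>; undoing the scaling yields the witness
  \<open>(norm c)\<^sup>2\<close>.\<close>

lemma spos_square:
  fixes c :: "'a::{cstar_algebra,monoid_mult}"
  assumes c: "star c = c"
  shows "spos (c * c)"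
proof (cases "c = 0")
  case False
  define d where "d = c /\<^sub>R norm c"
  have d: "star d = d" by (simp add: d_def star_scaleR c)
  have nd: "norm d = 1" using False by (simp add: d_def)
  have dd: "star (d * d) = d * d" by (simp add: star_mult d)
  have "norm (d * d) \<le> 1" by (simp add: norm_square_selfadjoint d nd)
  with dd obtain w where w: "star w = w" "w * w = 1 - d * d" "\<And>y. y * (d * d) = (d * d) * y \<Longrightarrow> y * w = w * y"
    using sqrt_one_minus by blast
  have "d * w = w * d" by (rule w(3)) (simp add: mult.assoc)
  then have "(norm w)\<^sup>2 \<le> norm (w * w + d * d)"
    using norm_square_le_sum_squares[of w d] w(1) d by simp
  then have "(norm w)\<^sup>2 \<le> 1"
    using norm_one_le[where 'a='a] by (simp add: w(2))
  then have n1: "norm (1 - d * d) \<le> 1"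
    using norm_square_selfadjoint[OF w(1)] by (simp add: w(2))
  have "(norm c)\<^sup>2 *\<^sub>R 1 - c * c = (norm c)\<^sup>2 *\<^sub>R (1 - d * d)"
    using False by (simp add: d_def algebra_simps power2_eq_square)
  then have "norm ((norm c)\<^sup>2 *\<^sub>R 1 - c * c) \<le> (norm c)\<^sup>2"
    using mult_left_mono[OF n1, of "(norm c)\<^sup>2"] by simp
  then show ?thesis
    by (auto simp: spos_def star_mult c intro!: exI[of _ "(norm c)\<^sup>2"])
qed (auto simp: spos_def)

text \<open>With \<open>s = norm b\<close>, the element \<open>s *\<^sub>R 1 - a\<close> is positive
  as the sum of \<open>s *\<^sub>R 1 - b\<close> and \<open>b - a\<close>. Commuting roots
  \<open>w\<close> of it and \<open>k\<close> of \<open>a\<close> satisfy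
  \<open>k * k + w * w = s *\<^sub>R 1\<close>, so \<open>norm_square_le_sum_squares\<close> bounds
  \<open>norm a = (norm k)\<^sup>2\<close> by \<open>s\<close>.\<close>

lemma spos_norm_mono:
  assumes a: "spos a" and ba: "spos (b - a)"
  shows "norm a \<le> norm b"
proof -
  define s where "s = norm b"
  have "star b = b" using spos_selfadjoint[OF spos_add[OF a ba]] by simp
  then have "spos ((s *\<^sub>R 1 - b) + (b - a))"
    by (intro spos_add ba spos_norm_minus) (auto simp: s_def)
  then have "spos (s *\<^sub>R 1 - a)" by simp
  then obtain w where w: "spos w" "w * w = s *\<^sub>R 1 - a"
      "\<And>y. y * (s *\<^sub>R 1 - a) = (s *\<^sub>R 1 - a) * y \<Longrightarrow> y * w = w * y"
    using spos_sqrt by blast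
  obtain k where k: "spos k" "k * k = a" "\<And>y. y * a = a * y \<Longrightarrow> y * k = k * y"
    using spos_sqrt[OF a] by blast
  have "k * a = a * k" unfolding k(2)[symmetric] by (simp add: mult.assoc)
  then have "k * (s *\<^sub>R 1 - a) = (s *\<^sub>R 1 - a) * k" by (simp add: algebra_simps)
  then have "k * w = w * k" by (rule w(3))
  then have "(norm k)\<^sup>2 \<le> norm (k * k + w * w)"
    by (intro norm_square_le_sum_squares spos_selfadjoint k(1) w(1))
  moreover have "k * k + w * w = s *\<^sub>R 1" by (simp add: k(2) w(2))
  moreover have "norm a = (norm k)\<^sup>2"
    using norm_square_selfadjoint[OF spos_selfadjoint[OF k(1)]] by (simp add: k(2))
  ultimately have "norm a \<le> norm (s *\<^sub>R (1::'a))" by simp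
  also have "\<dots> \<le> s"
    using norm_one_le[where 'a='a] by (simp add: s_def mult_left_le)
  finally show ?thesis by (simp add: s_def)
qed

text \<open>Since \<open>b = 0 - a\<close>, norm monotonicity bounds \<open>norm a\<close> by
  \<open>norm 0\<close>: the positive cone is proper.\<close>

lemma spos_add_eq_0:
  assumes "spos a" "spos b" "a + b = 0"
  shows "a = 0"
proof -
  have "b = 0 - a" using assms(3) by (simp add: eq_neg_iff_add_eq_0 add.commute)
  then show ?thesis using spos_norm_mono[of a 0] assms(1,2) by simp
qed

text \<open>With \<open>x\<close> split into its real and imaginary parts \<open>a\<close> and
  \<open>b\<close>, the sum is twice \<open>a * a + b * b\<close>.\<close>

lemma spos_star_mult_add:
  "spos (star x * x + x * star x)"
proof -
  define a where "a = (1/2) *\<^sub>R (x + star x)"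
  define b where "b = \<i> *\<^sub>C ((1/2) *\<^sub>R (star x - x))"
  have a: "star a = a" by (simp add: a_def star_scaleR star_add star_star add.commute)
  have b: "star b = b" by (simp add: b_def star_scaleR star_diff star_star star_scaleC scaleR_diff_right scaleC_diff_right)
  have aa: "a * a = (1/4) *\<^sub>R ((x + star x) * (x + star x))" by (simp add: a_def)
  have bb: "b * b = (1/4) *\<^sub>R (- ((star x - x) * (star x - x)))"
  proof -
    have "(\<i> *\<^sub>C c) * (\<i> *\<^sub>C c) = - (c * c)" for c :: 'a
      by (simp add: mult_scaleC_left mult_scaleC_right scaleC_scaleC)
    then show ?thesis unfolding b_def by simp
  qed
  have "(x + star x) * (x + star x) + - ((star x - x) * (star x - x))
      = 2 *\<^sub>R (star x * x + x * star x)"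
    by (simp add: algebra_simps scaleR_2)
  then have "a * a + b * b = (1/2) *\<^sub>R (star x * x + x * star x)"
    unfolding aa bb scaleR_add_right[symmetric] by simp
  then have "star x * x + x * star x = (a * a + b * b) + (a * a + b * b)"
    by (simp flip: scaleR_2)
  then show ?thesis by (simp add: spos_add spos_square a b)
qed

text \<open>For \<open>y = em\<close> both \<open>yy\<^sup>*\<close> and \<open>y\<^sup>*y\<close> are negatives of squares, but their sum is positive.\<close>

lemma star_mult_eq_neg_square_imp_0:
  assumes m: "star m = m" and e: "star e * e = - (m * m)"
  shows "e = (0::'a::{cstar_algebra,monoid_mult})"
proof -
  define z where "z = e * star e"
  define y where "y = e * m"
  have z: "star z = z" by (simp add: z_def star_mult star_star)
  have "y * star y = - (z * z)"
  proof -
    have "y * star y = e * (m * m) * star e" by (simp add: y_def star_mult m mult.assoc)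
    also have "m * m = - (star e * e)" by (simp add: e)
    finally show ?thesis by (simp add: z_def mult.assoc)
  qed
  moreover have "star y * y = - ((m * m) * (m * m))"
  proof -
    have "star y * y = m * (star e * e) * m" by (simp add: y_def star_mult m mult.assoc)
    then show ?thesis by (simp add: e mult.assoc)
  qed
  \<comment> \<open>The fourth power of \<open>m\<close> is added to cancel
    \<open>star y * y\<close>; what remains is a sum of two positive elements that vanishes.\<close>
  ultimately have "z * z + ((m * m) * (m * m) + (star y * y + y * star y)) = 0"
    by simp
  moreover have "spos (z * z)" by (simp add: spos_square z)
  moreover have "spos ((m * m) * (m * m) + (star y * y + y * star y))"
    by (intro spos_add spos_star_mult_add spos_square) (simp add: star_mult m)
  ultimately have "z * z = 0" using spos_add_eq_0 by blast
  then have "z = 0" using norm_square_selfadjoint[OF z] by simp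
  then have "norm (star e) = 0" using norm_star_mult[of "star e"] by (simp add: z_def star_star)
  then show ?thesis by (simp add: norm_star)
qed

text \<open>Kaplansky's argument with \<open>h = d\<^sup>*d\<close>, \<open>q = |h|\<close> and \<open>n = q - h\<close>: from \<open>hn = -qn\<close> one gets
  \<open>(dn)\<^sup>*(dn) = -nqn \<le> 0\<close>, which forces \<open>n = 0\<close>.\<close>

theorem spos_star_mult: "spos (star d * d)"
proof -
  define h where "h = star d * d"
  have h: "star h = h" by (simp add: h_def star_mult star_star)
  obtain q where q: "spos q" "q * q = h * h" "\<And>y. y * (h * h) = (h * h) * y \<Longrightarrow> y * q = q * y"
    using spos_sqrt[OF spos_square[OF h]] by blast
  have hq: "h * q = q * h" by (rule q(3)) (simp add: mult.assoc)
  \<comment> \<open>The root \<open>k\<close> turns \<open>n * (q * n)\<close> into the square of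
    the self-adjoint element \<open>k * n\<close>, as \<open>star_mult_eq_neg_square_imp_0\<close>
    requires.\<close>
  obtain k where k: "spos k" "k * k = q" "\<And>y. y * q = q * y \<Longrightarrow> y * k = k * y"
    using spos_sqrt[OF q(1)] by blast
  define n where "n = q - h"
  have n: "star n = n" by (simp add: n_def star_diff h spos_selfadjoint q)
  have nq: "n * q = q * n" by (simp add: n_def algebra_simps hq)
  have nk: "n * k = k * n" by (rule k(3)) (rule nq)
  have hn: "h * n = - (q * n)" by (simp add: n_def algebra_simps hq q(2))
  have kn: "star (k * n) = k * n" by (simp add: star_mult n spos_selfadjoint k nk)
  have sq: "(k * n) * (k * n) = n * (q * n)"
    by (metis k(2) mult.assoc nk)
  have "star (d * n) * (d * n) = n * (h * n)"
    by (simp add: star_mult n h_def mult.assoc)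
  also have "\<dots> = - ((k * n) * (k * n))" by (simp add: hn sq)
  finally have "d * n = 0" using star_mult_eq_neg_square_imp_0[OF kn] by blast
  \<comment> \<open>From here \<open>h * n\<close> and then \<open>q * n\<close> vanish, hence also
    their difference \<open>n * n\<close>.\<close>
  then have "h * n = 0" by (simp add: h_def mult.assoc)
  with hn have "q * n = 0" by simp
  with \<open>h * n = 0\<close> have "n * n = 0" by (simp add: n_def algebra_simps)
  then have "n = 0" using norm_square_selfadjoint[OF n] by simp
  then show ?thesis using q(1) by (simp add: n_def h_def)
qed

section \<open>The multiplier algebra\<close>

text \<open>A C*-algebra without unit embeds isometrically into the unital C*-algebra of adjointable
  operators on it, where \<open>A\<close> is a right Hilbert module over itself with inner product \<open>x\<^sup>*y\<close>.\<close>

definition adjoint_blinfun :: "('a::cstar_algebra \<Rightarrow>\<^sub>L 'a) \<Rightarrow> ('a \<Rightarrow>\<^sub>L 'a) \<Rightarrow> bool"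
  where "adjoint_blinfun T T' \<longleftrightarrow> (\<forall>x y. star (T x) * y = star x * T' y)"

lemma adjoint_blinfunD: "adjoint_blinfun T T' \<Longrightarrow> star (T x) * y = star x * T' y"
  by (simp add: adjoint_blinfun_def)

lemma adjoint_blinfun_sym: "adjoint_blinfun T T' \<Longrightarrow> adjoint_blinfun T' T"
  unfolding adjoint_blinfun_def by (metis star_mult star_star)

text \<open>Nondegeneracy of the inner product \<open>star x * y\<close>: take
  \<open>x = a - b\<close> and use the C*-identity.\<close>

lemma star_mult_left_cancel:
  fixes a b :: "'a::cstar_algebra"
  assumes "\<And>x. star x * a = star x * b"
  shows "a = b"
proof -
  have "star (a - b) * (a - b) = 0" by (simp add: assms right_diff_distrib)
  then show ?thesis using norm_star_mult[of "a - b"] by simp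
qed

lemma adjoint_blinfun_unique:
  "adjoint_blinfun T T' \<Longrightarrow> adjoint_blinfun T T'' \<Longrightarrow> T' = T''"
  by (rule blinfun_eqI, rule star_mult_left_cancel) (metis adjoint_blinfunD)

text \<open>The identity \<open>star (T x) * T x = star x * T' (T x)\<close> bounds the square of
  \<open>norm T\<close> by the norm of the composite. The same estimate for \<open>T'\<close> gives
  \<open>norm T' \<le> norm T\<close>, hence the other inequality.\<close>

lemma adjoint_blinfun_norm_compose:
  assumes adj: "adjoint_blinfun T T'"
  shows "norm (T' o\<^sub>L T) = (norm T)\<^sup>2"
proof -
  have le: "(norm T)\<^sup>2 \<le> norm (T' o\<^sub>L T)" if adj: "adjoint_blinfun T T'" for T T' :: "'a \<Rightarrow>\<^sub>L 'a"
  proof -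
    have "norm T \<le> sqrt (norm (T' o\<^sub>L T))"
    proof (rule norm_blinfun_bound)
      fix x
      have "(norm (T x))\<^sup>2 = norm (star x * (T' o\<^sub>L T) x)"
        using norm_star_mult[of "T x"] adjoint_blinfunD[OF adj, of x "T x"] by simp
      also have "\<dots> \<le> norm x * (norm (T' o\<^sub>L T) * norm x)"
        using order_trans[OF norm_mult_ineq mult_left_mono[OF norm_blinfun norm_ge_zero]]
        by (metis norm_star)
      also have "\<dots> = (sqrt (norm (T' o\<^sub>L T)) * norm x)\<^sup>2"
        by (simp add: power2_eq_square algebra_simps)
      finally show "norm (T x) \<le> sqrt (norm (T' o\<^sub>L T)) * norm x"
        by (rule power2_le_imp_le) simp
    qed simp
    from power_mono[OF this norm_ge_zero, of 2] show ?thesis by simp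
  qed
  have T'_le: "norm T' \<le> norm T"
  proof (cases "T' = 0")
    case False
    have "norm T' * norm T' \<le> norm T * norm T'"
      using le[OF adjoint_blinfun_sym[OF adj]] norm_blinfun_compose[of T T']
      by (simp add: power2_eq_square)
    then show ?thesis using False by simp
  qed simp
  have "norm (T' o\<^sub>L T) \<le> norm T * norm T"
    using norm_blinfun_compose[of T' T] mult_right_mono[OF T'_le norm_ge_zero[of T]] by linarith
  with le[OF adj] show ?thesis by (simp add: power2_eq_square)
qed

lemma adjoint_blinfun_norm:
  assumes "adjoint_blinfun T T'"
  shows "norm T' = norm T"
proof -
  have "norm S \<le> norm S'" if "adjoint_blinfun S S'" for S S' :: "'a \<Rightarrow>\<^sub>L 'a"
  proof (cases "S = 0")
    case False
    have "norm S * norm S \<le> norm S' * norm S"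
      using adjoint_blinfun_norm_compose[OF that] norm_blinfun_compose[of S' S]
      by (simp add: power2_eq_square)
    then show ?thesis using False by simp
  qed simp
  from this[OF assms] this[OF adjoint_blinfun_sym[OF assms]] show ?thesis by simp
qed

lemma adjoint_blinfun_add:
  "adjoint_blinfun S S' \<Longrightarrow> adjoint_blinfun T T' \<Longrightarrow> adjoint_blinfun (S + T) (S' + T')"
  by (simp add: adjoint_blinfun_def blinfun.add_left star_add algebra_simps)

lemma adjoint_blinfun_scaleR:
  "adjoint_blinfun T T' \<Longrightarrow> adjoint_blinfun (r *\<^sub>R T) (r *\<^sub>R T')"
  by (simp add: adjoint_blinfun_def blinfun.scaleR_left star_scaleR)

lemma adjoint_blinfun_diff:
  "adjoint_blinfun S S' \<Longrightarrow> adjoint_blinfun T T' \<Longrightarrow> adjoint_blinfun (S - T) (S' - T')"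
  by (simp add: adjoint_blinfun_def blinfun.diff_left star_diff algebra_simps)

lemma adjoint_blinfun_zero: "adjoint_blinfun 0 0"
  by (simp add: adjoint_blinfun_def)

lemma adjoint_blinfun_id: "adjoint_blinfun id_blinfun id_blinfun"
  by (simp add: adjoint_blinfun_def)

lemma adjoint_blinfun_compose:
  "adjoint_blinfun S S' \<Longrightarrow> adjoint_blinfun T T' \<Longrightarrow> adjoint_blinfun (S o\<^sub>L T) (T' o\<^sub>L S')"
  by (simp add: adjoint_blinfun_def)

section \<open>Complex scalars and the C*-structure on multipliers\<close>

lemma bounded_linear_scaleC: "bounded_linear ((*\<^sub>C) c :: 'a::complex_banach \<Rightarrow> 'a)"
proof (rule bounded_linear_intro[where K="cmod c"])
  show "c *\<^sub>C (r *\<^sub>R x) = r *\<^sub>R (c *\<^sub>C x)" for r and x :: 'a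
    by (simp add: scaleC_scaleC mult.commute flip: scaleC_of_real)
qed (simp_all add: scaleC_add_right norm_scaleC)

text \<open>Operators of this type are only real linear, so a complex scalar is encoded as an
  operator and scaling as composition with it.\<close>

definition scaleC_blinfun :: "complex \<Rightarrow> ('a::complex_banach \<Rightarrow>\<^sub>L 'a)"
  where "scaleC_blinfun c = Blinfun ((*\<^sub>C) c)"

lemma scaleC_blinfun_apply [simp]: "blinfun_apply (scaleC_blinfun c) x = c *\<^sub>C x"
  by (simp add: scaleC_blinfun_def bounded_linear_Blinfun_apply bounded_linear_scaleC)

lemma adjoint_blinfun_scaleC:
  assumes "adjoint_blinfun T T'"
  shows "adjoint_blinfun (scaleC_blinfun c o\<^sub>L T) (scaleC_blinfun (cnj c) o\<^sub>L T')"
  using assms by (simp add: adjoint_blinfun_def star_scaleC mult_scaleC_left mult_scaleC_right)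

text \<open>Both sides of the adjoint identity are continuous in the operator norm; this yields
  completeness of the multiplier algebra.\<close>

lemma adjoint_blinfun_limit:
  assumes adj: "\<And>n. adjoint_blinfun (S n) (S' n)" and S: "S \<longlonglongrightarrow> T" and S': "S' \<longlonglongrightarrow> T'"
  shows "adjoint_blinfun T T'"
  unfolding adjoint_blinfun_def
proof (intro allI)
  fix x y
  have "(\<lambda>n. star (S n x) * y) \<longlonglongrightarrow> star (T x) * y"
    by (intro tendsto_mult tendsto_const bounded_linear.tendsto[OF bounded_linear_star]
        blinfun.tendsto S)
  moreover have "(\<lambda>n. star x * S' n y) \<longlonglongrightarrow> star x * T' y"
    by (intro tendsto_mult tendsto_const blinfun.tendsto S')
  ultimately show "star (T x) * y = star x * T' y"
    using adj LIMSEQ_unique by (simp add: adjoint_blinfun_def)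
qed

text \<open>Only real linearity is built in; the existence of an adjoint forces complex
  linearity.\<close>

typedef (overloaded) ('a::cstar_algebra) multiplier =
  "{T :: 'a \<Rightarrow>\<^sub>L 'a. \<exists>T'. adjoint_blinfun T T'}"
  using adjoint_blinfun_zero by blast

setup_lifting type_definition_multiplier

instantiation multiplier :: (cstar_algebra) real_normed_vector
begin

lift_definition zero_multiplier :: "'a multiplier" is 0
  using adjoint_blinfun_zero by blast

lift_definition plus_multiplier :: "'a multiplier \<Rightarrow> 'a multiplier \<Rightarrow> 'a multiplier" is "(+)"
  using adjoint_blinfun_add by blast

lift_definition minus_multiplier :: "'a multiplier \<Rightarrow> 'a multiplier \<Rightarrow> 'a multiplier" is "(-)"
  using adjoint_blinfun_diff by blast

lift_definition uminus_multiplier :: "'a multiplier \<Rightarrow> 'a multiplier" is uminus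
  using adjoint_blinfun_scaleR[of _ _ "-1"] by auto

lift_definition scaleR_multiplier :: "real \<Rightarrow> 'a multiplier \<Rightarrow> 'a multiplier" is "(*\<^sub>R)"
  using adjoint_blinfun_scaleR by blast

lift_definition norm_multiplier :: "'a multiplier \<Rightarrow> real" is norm .

definition dist_multiplier :: "'a multiplier \<Rightarrow> 'a multiplier \<Rightarrow> real"
  where "dist_multiplier S T = norm (S - T)"

definition sgn_multiplier :: "'a multiplier \<Rightarrow> 'a multiplier"
  where "sgn_multiplier T = scaleR (inverse (norm T)) T"

definition uniformity_multiplier :: "('a multiplier \<times> 'a multiplier) filter"
  where "uniformity_multiplier = (INF e\<in>{0<..}. principal {(S, T). dist S T < e})"

definition open_multiplier :: "'a multiplier set \<Rightarrow> bool"
  where "open_multiplier U \<longleftrightarrow> (\<forall>S\<in>U. \<forall>\<^sub>F (S', T) in uniformity. S' = S \<longrightarrow> T \<in> U)"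

instance
proof
  fix S T :: "'a multiplier" and r :: real
  show "norm (S + T) \<le> norm S + norm T" by transfer (rule norm_triangle_ineq)
  show "norm S = 0 \<longleftrightarrow> S = 0" by transfer simp
  show "norm (r *\<^sub>R S) = \<bar>r\<bar> * norm S" by transfer simp
qed (simp_all only: dist_multiplier_def sgn_multiplier_def uniformity_multiplier_def
      open_multiplier_def, (transfer, simp add: algebra_simps)+)

end

instantiation multiplier :: (cstar_algebra) "{cstar_algebra, monoid_mult}"
begin

lift_definition one_multiplier :: "'a multiplier" is id_blinfun
  using adjoint_blinfun_id by blast

lift_definition times_multiplier :: "'a multiplier \<Rightarrow> 'a multiplier \<Rightarrow> 'a multiplier" is "(o\<^sub>L)"
  using adjoint_blinfun_compose by blast

lift_definition scaleC_multiplier :: "complex \<Rightarrow> 'a multiplier \<Rightarrow> 'a multiplier"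
  is "\<lambda>c T. scaleC_blinfun c o\<^sub>L T"
  using adjoint_blinfun_scaleC by blast

lift_definition star_multiplier :: "'a multiplier \<Rightarrow> 'a multiplier"
  is "\<lambda>T. THE T'. adjoint_blinfun T T'"
  by (metis adjoint_blinfun_sym adjoint_blinfun_unique theI)

lemma adjoint_blinfun_star:
  "adjoint_blinfun (Rep_multiplier T) (Rep_multiplier (star T))"
  unfolding star_multiplier.rep_eq
  using Rep_multiplier[of T] by (auto intro: theI adjoint_blinfun_unique)

lemma star_multiplier_eqI:
  "adjoint_blinfun (Rep_multiplier T) (Rep_multiplier T') \<Longrightarrow> star T = T'"
  using adjoint_blinfun_star adjoint_blinfun_unique Rep_multiplier_inject by blast

instance
proof
  fix X :: "nat \<Rightarrow> 'a multiplier"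
  assume X: "Cauchy X"
  have dist_Rep: "dist (Rep_multiplier S) (Rep_multiplier T) = dist S T" for S T :: "'a multiplier"
    unfolding dist_norm by transfer simp
  have dist_star: "dist (Rep_multiplier (star S)) (Rep_multiplier (star T)) = dist S T"
    for S T :: "'a multiplier"
    using adjoint_blinfun_norm[OF adjoint_blinfun_diff[OF adjoint_blinfun_star[of S] adjoint_blinfun_star[of T]]]
      dist_Rep[of S T] by (simp add: dist_norm)
  \<comment> \<open>As \<open>star\<close> is isometric, the operators and their adjoints converge
    together, and the limits are adjoint to each other.\<close>
  obtain T where T: "(\<lambda>n. Rep_multiplier (X n)) \<longlonglongrightarrow> T"
    using X by (metis (no_types, lifting) Cauchy_convergent_iff Cauchy_def convergent_def dist_Rep)
  obtain T' where T': "(\<lambda>n. Rep_multiplier (star (X n))) \<longlonglongrightarrow> T'"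
    using X by (metis (no_types, lifting) Cauchy_convergent_iff Cauchy_def convergent_def dist_star)
  have "adjoint_blinfun T T'"
    by (rule adjoint_blinfun_limit[OF adjoint_blinfun_star T T'])
  then obtain L where L: "T = Rep_multiplier L" by (metis (mono_tags) Rep_multiplier_cases mem_Collect_eq)
  have "X \<longlonglongrightarrow> L" using T unfolding L tendsto_iff dist_Rep .
  then show "convergent X" by (auto simp: convergent_def)
next
  fix R S T :: "'a multiplier" and c d :: complex and r :: real
  show "c *\<^sub>C (S + T) = c *\<^sub>C S + c *\<^sub>C T"
    by transfer (auto intro!: blinfun_eqI simp: blinfun.add_left scaleC_add_right)
  show "(c + d) *\<^sub>C S = c *\<^sub>C S + d *\<^sub>C S"
    by transfer (auto intro!: blinfun_eqI simp: blinfun.add_left scaleC_add_left)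
  show cc: "c *\<^sub>C d *\<^sub>C S = (c * d) *\<^sub>C S" for c d and S :: "'a multiplier"
    by transfer (auto intro!: blinfun_eqI simp: scaleC_scaleC)
  show of_real: "complex_of_real r *\<^sub>C S = r *\<^sub>R S" for r and S :: "'a multiplier"
    by transfer (auto intro!: blinfun_eqI simp: blinfun.scaleR_left scaleC_of_real)
  \<comment> \<open>Only the upper bound is direct; for the reverse it is applied to
    \<open>inverse c\<close>.\<close>
  have le: "norm (c *\<^sub>C S) \<le> cmod c * norm S" for c and S :: "'a multiplier"
  proof (transfer, rule norm_blinfun_bound)
    fix c and S :: "'a \<Rightarrow>\<^sub>L 'a" and x
    show "norm ((scaleC_blinfun c o\<^sub>L S) x) \<le> cmod c * norm S * norm x"
      by (simp add: norm_scaleC mult.assoc mult_left_mono norm_blinfun)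
  qed simp
  show "norm (c *\<^sub>C S) = cmod c * norm S"
  proof (cases "c = 0")
    case False
    have "norm S = norm (inverse c *\<^sub>C c *\<^sub>C S)"
      using of_real[of 1 S] by (simp add: cc False)
    also have "\<dots> \<le> norm (c *\<^sub>C S) / cmod c"
      using le[of "inverse c" "c *\<^sub>C S"] by (simp add: norm_inverse divide_inverse mult.commute)
    finally show ?thesis using le[of c S] False by (simp add: field_simps)
  qed (use le[of 0 S] in simp)
  show "R * S * T = R * (S * T)"
    by transfer (auto intro!: blinfun_eqI)
  show "(R + S) * T = R * T + S * T"
    by transfer (auto intro!: blinfun_eqI simp: blinfun.add_left)
  show "R * (S + T) = R * S + R * T"
    by transfer (auto intro!: blinfun_eqI simp: blinfun.add_left blinfun.add_right)
  show "r *\<^sub>R S * T = r *\<^sub>R (S * T)"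
    by transfer (auto intro!: blinfun_eqI simp: blinfun.scaleR_left)
  show "S * r *\<^sub>R T = r *\<^sub>R (S * T)"
    by transfer (auto intro!: blinfun_eqI simp: blinfun.scaleR_left blinfun.scaleR_right)
  show "norm (S * T) \<le> norm S * norm T" by transfer (rule norm_blinfun_compose)
  show "1 * S = S" by transfer (auto intro!: blinfun_eqI)
  show "S * 1 = S" by transfer (auto intro!: blinfun_eqI)
  show "c *\<^sub>C S * T = c *\<^sub>C (S * T)" by transfer (auto intro!: blinfun_eqI)
  show "S * c *\<^sub>C T = c *\<^sub>C (S * T)"
  proof transfer
    fix S T :: "'a \<Rightarrow>\<^sub>L 'a" and c
    assume "\<exists>S'. adjoint_blinfun S S'"
    then obtain S' where S': "adjoint_blinfun S' S" using adjoint_blinfun_sym by blast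
    \<comment> \<open>In \<open>star y * S (c *\<^sub>C x)\<close> the operator passes to the left
      factor as \<open>S'\<close>, and then \<open>c\<close> can be pulled out.\<close>
    have "S (c *\<^sub>C x) = c *\<^sub>C S x" for x
      by (rule star_mult_left_cancel)
        (simp add: mult_scaleC_right adjoint_blinfunD[OF S', symmetric])
    then show "S o\<^sub>L (scaleC_blinfun c o\<^sub>L T) = scaleC_blinfun c o\<^sub>L (S o\<^sub>L T)"
      by (auto intro!: blinfun_eqI)
  qed
  show "star (star S) = S"
    by (rule star_multiplier_eqI[OF adjoint_blinfun_sym[OF adjoint_blinfun_star]])
  show "star (S + T) = star S + star T"
    by (rule star_multiplier_eqI, unfold plus_multiplier.rep_eq)
      (rule adjoint_blinfun_add[OF adjoint_blinfun_star adjoint_blinfun_star])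
  show "star (c *\<^sub>C S) = cnj c *\<^sub>C star S"
    by (rule star_multiplier_eqI, unfold scaleC_multiplier.rep_eq)
      (rule adjoint_blinfun_scaleC[OF adjoint_blinfun_star])
  show "star (S * T) = star T * star S"
    by (rule star_multiplier_eqI, unfold times_multiplier.rep_eq)
      (rule adjoint_blinfun_compose[OF adjoint_blinfun_star adjoint_blinfun_star])
  show "norm (star S * S) = (norm S)\<^sup>2"
    using adjoint_blinfun_norm_compose[OF adjoint_blinfun_star[of S]]
    by (simp add: norm_multiplier.rep_eq times_multiplier.rep_eq)
qed

end

section \<open>The isometric embedding by left multiplication\<close>

lift_definition left_mult :: "'a::cstar_algebra \<Rightarrow> 'a multiplier" is blinfun_mult_right
  by (auto intro!: exI[of _ "blinfun_mult_right (star _)"] simp: adjoint_blinfun_def star_mult mult.assoc)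

lemma left_mult_add: "left_mult (a + b) = left_mult a + left_mult b"
  by transfer (auto intro!: blinfun_eqI simp: blinfun.add_left algebra_simps)

lemma left_mult_diff: "left_mult (a - b) = left_mult a - left_mult b"
  by transfer (rule blinfun_eqI, simp add: blinfun.diff_left left_diff_distrib)

lemma left_mult_scaleR: "left_mult (r *\<^sub>R a) = r *\<^sub>R left_mult a"
  by transfer (auto intro!: blinfun_eqI simp: blinfun.scaleR_left)

lemma left_mult_mult: "left_mult (a * b) = left_mult a * left_mult b"
  by transfer (auto intro!: blinfun_eqI simp: mult.assoc)

lemma left_mult_star: "left_mult (star a) = star (left_mult a)"
  by (rule star_multiplier_eqI[symmetric])
    (simp add: left_mult.rep_eq adjoint_blinfun_def star_mult mult.assoc)

text \<open>For the lower bound the operator is evaluated at \<open>star a\<close>, where the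
  C*-identity computes the norm of \<open>a * star a\<close>.\<close>

lemma norm_left_mult: "norm (left_mult a) = norm (a::'a::cstar_algebra)"
proof (rule antisym)
  show "norm (left_mult a) \<le> norm a"
    unfolding norm_multiplier.rep_eq left_mult.rep_eq
    by (rule norm_blinfun_bound) (simp_all add: norm_mult_ineq)
  have "norm a * norm a \<le> norm (left_mult a) * norm a"
    using norm_star_mult[of "star a"] norm_blinfun[of "Rep_multiplier (left_mult a)" "star a"]
    by (simp add: norm_multiplier.rep_eq left_mult.rep_eq star_star norm_star power2_eq_square)
  then show "norm a \<le> norm (left_mult a)" by (cases "a = 0") auto
qed

section \<open>Norm inequalities for positive elements without a unit\<close>

lemma cpositive_imp_spos_left_mult: "cpositive a \<Longrightarrow> spos (left_mult a)"
  by (auto simp: cpositive_def left_mult_mult left_mult_star spos_star_mult)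

text \<open>The embedding \<open>left_mult\<close> is isometric and preserves positivity, so
  monotonicity is inherited from the unital case.\<close>

lemma norm_le_if_cle:
  assumes "cpositive a" "cle a b"
  shows "norm a \<le> norm b"
  using spos_norm_mono[of "left_mult a" "left_mult b"] assms
  by (simp add: cle_def cpositive_imp_spos_left_mult norm_left_mult flip: left_mult_diff)

text \<open>Here \<open>x\<close>, \<open>y\<close>, \<open>z\<close> stand for the inner products
  of f with f, g with g and f with g, and \<open>pos\<close> for the positivity of the inner product
  of af + g with itself. Taking \<open>a\<close> to be \<open>- l\<close> times
  \<open>star z\<close> and estimating \<open>x\<close> by its norm shows that
  \<open>2 * l - l\<^sup>2 * norm x\<close> times \<open>star z * z\<close> is at most
  \<open>y\<close>; then \<open>l\<close> is optimised.\<close>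

lemma cpositive_Cauchy_Schwarz:
  fixes x y z :: "'a::cstar_algebra"
  assumes x: "cpositive x"
    and pos: "\<And>a. cpositive (a * x * star a + a * z + star z * star a + y)"
  shows "(norm z)\<^sup>2 \<le> norm x * norm y"
proof -
  define X Y Z where "X = left_mult x" and "Y = left_mult y" and "Z = left_mult z"
  have X: "spos X" unfolding X_def by (rule cpositive_imp_spos_left_mult[OF x])
  \<comment> \<open>The root \<open>w\<close> exhibits the defect in the estimate of
    \<open>star Z * X * Z\<close> as \<open>star (w * Z) * (w * Z)\<close>.\<close>
  then have "spos (norm X *\<^sub>R 1 - X)" by (intro spos_norm_minus spos_selfadjoint) auto
  then obtain w where w: "spos w" "w * w = norm X *\<^sub>R 1 - X"
    using spos_sqrt by metis
  have "star (w * Z) * (w * Z) = star Z * (w * w) * Z"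
    by (simp add: star_mult spos_selfadjoint w(1) mult.assoc)
  also have "\<dots> = norm X *\<^sub>R (star Z * Z) - star Z * X * Z"
    by (simp add: w(2) algebra_simps)
  finally have ZXZ: "spos (norm X *\<^sub>R (star Z * Z) - star Z * X * Z)"
    using spos_star_mult[of "w * Z"] by simp
  have bound: "(2 * l - l\<^sup>2 * norm x) * (norm z)\<^sup>2 \<le> norm y" if "0 \<le> 2 * l - l\<^sup>2 * norm x" for l
  proof -
    define c where "c = 2 * l - l\<^sup>2 * norm x"
    have c: "c \<ge> 0" using that by (simp add: c_def)
    have "spos ((-l) *\<^sub>R star Z * X * star ((-l) *\<^sub>R star Z) + (-l) *\<^sub>R star Z * Z
        + star Z * star ((-l) *\<^sub>R star Z) + Y)"
      using cpositive_imp_spos_left_mult[OF pos[of "(-l) *\<^sub>R star z"]]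
      unfolding X_def Y_def Z_def left_mult_star[symmetric] left_mult_scaleR[symmetric]
        left_mult_mult[symmetric] left_mult_add[symmetric] .
    then have "spos (l\<^sup>2 *\<^sub>R (star Z * X * Z) - (2 * l) *\<^sub>R (star Z * Z) + Y)"
      by (simp add: star_scaleR star_star star_minus scaleR_2 power2_eq_square algebra_simps
          flip: scaleR_scaleR)
    moreover have "spos (l\<^sup>2 *\<^sub>R (norm X *\<^sub>R (star Z * Z) - star Z * X * Z))"
      using ZXZ spos_scaleR zero_le_power2 by blast
    ultimately have "spos ((l\<^sup>2 *\<^sub>R (star Z * X * Z) - (2 * l) *\<^sub>R (star Z * Z) + Y)
        + l\<^sup>2 *\<^sub>R (norm X *\<^sub>R (star Z * Z) - star Z * X * Z))"
      by (rule spos_add)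
    then have "spos (Y - c *\<^sub>R (star Z * Z))"
      by (simp add: c_def X_def norm_left_mult algebra_simps)
    moreover have "spos (c *\<^sub>R (star Z * Z))"
      by (intro spos_scaleR c spos_star_mult)
    ultimately have "norm (c *\<^sub>R (star Z * Z)) \<le> norm Y" by (intro spos_norm_mono)
    then show ?thesis
      using c by (simp add: norm_star_mult Y_def Z_def norm_left_mult c_def)
  qed
  show ?thesis
  proof (cases "norm x = 0")
    case False
    then have nx: "norm x > 0" by simp
    \<comment> \<open>The choice \<open>l = 1 / norm x\<close> maximises the factor.\<close>
    have e: "2 * (1 / norm x) - (1 / norm x)\<^sup>2 * norm x = 1 / norm x"
      using nx by (simp add: field_simps power2_eq_square)
    show ?thesis
      using bound[of "1 / norm x"] nx unfolding e by (simp add: field_simps)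
  next
    case True
    show ?thesis
    proof (rule ccontr)
      assume "\<not> ?thesis"
      then have nz: "(norm z)\<^sup>2 > 0" using True by simp
      \<comment> \<open>For \<open>norm x = 0\<close> the factor is \<open>2 * l\<close>, and this
        \<open>l\<close> turns the bound into \<open>norm y + 1 \<le> norm y\<close>.\<close>
      then show False
        using bound[of "(norm y + 1) / (2 * (norm z)\<^sup>2)"] True by (simp add: divide_simps)
    qed
  qed
qed

section \<open>Hilbert modules and the direct sum\<close>

lemma (in hilbert_cmodule) ip_diff_left: "ip (x - y) z = ip x z - ip y z"
  using ip_add_left[of "x - y" y z] by simp

lemma (in hilbert_cmodule) norm_square_ip: "(norm x)\<^sup>2 = norm (ip x x)"
  by (simp add: norm_eq_ip)

lemma (in hilbert_cmodule) ip_left_eqI: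
  assumes "\<And>z. ip x z = ip y z"
  shows "x = y"
proof -
  have "ip (x - y) (x - y) = 0" by (simp add: assms ip_diff_left)
  then show ?thesis using norm_eq_ip[of "x - y"] by simp
qed

section \<open>Inner product geometry of the direct sum\<close>

lemma direct_sum_hilbertD:
  assumes "direct_sum_hilbert M act ip V" and "f \<in> direct_sum M ip V" and "g \<in> direct_sum M ip V"
  shows direct_sum_add_in: "(\<lambda>m. f m + g m) \<in> direct_sum M ip V"
    and direct_sum_scaleC_in: "(\<lambda>m. c *\<^sub>C f m) \<in> direct_sum M ip V"
    and direct_sum_act_in: "(\<lambda>m. act a (f m)) \<in> direct_sum M ip V"
    and direct_sum_ip_ex: "\<exists>a. has_weak_integral M (\<lambda>m. ip (f m) (g m)) a"
    and direct_sum_ip_scaleC: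
      "direct_sum_ip M ip (\<lambda>m. c *\<^sub>C f m) g = c *\<^sub>C direct_sum_ip M ip f g"
    and direct_sum_ip_act: "direct_sum_ip M ip (\<lambda>m. act a (f m)) g = a * direct_sum_ip M ip f g"
    and direct_sum_ip_star: "star (direct_sum_ip M ip f g) = direct_sum_ip M ip g f"
    and direct_sum_ip_pos: "cpositive (direct_sum_ip M ip f f)"
    and direct_sum_ip_definite: "direct_sum_ip M ip f f = 0 \<Longrightarrow> AE m in M. f m = 0"
    and direct_sum_ip_add: "h \<in> direct_sum M ip V \<Longrightarrow>
      direct_sum_ip M ip (\<lambda>m. f m + g m) h = direct_sum_ip M ip f h + direct_sum_ip M ip g h"
  using assms by (simp_all add: direct_sum_hilbert_def)

lemma direct_sum_hilbert_integral:
  assumes "direct_sum_hilbert M act ip V" "f \<in> direct_sum M ip V" "g \<in> direct_sum M ip V"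
  shows "has_weak_integral M (\<lambda>m. ip (f m) (g m)) (direct_sum_ip M ip f g)"
  using direct_sum_ip_ex[OF assms] by (auto simp: direct_sum_ip_def weak_integral_eq)

text \<open>The family \<open>act a (f m) + g m\<close> has a positive inner product with itself for
  every \<open>a\<close>; expanding it gives the hypothesis of
  \<open>cpositive_Cauchy_Schwarz\<close>.\<close>

lemma direct_sum_Cauchy_Schwarz:
  assumes H: "direct_sum_hilbert M act ip V"
    and f: "f \<in> direct_sum M ip V" and g: "g \<in> direct_sum M ip V"
  shows "norm (direct_sum_ip M ip f g) \<le> direct_sum_norm M ip f * direct_sum_norm M ip g"
proof -
  let ?ip = "direct_sum_ip M ip"
  have "cpositive (a * ?ip f f * star a + a * ?ip f g + star (?ip f g) * star a + ?ip g g)" for a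
  proof -
    define h where "h = (\<lambda>m. act a (f m) + g m)"
    have af: "(\<lambda>m. act a (f m)) \<in> direct_sum M ip V" by (rule direct_sum_act_in[OF H f f])
    have h: "h \<in> direct_sum M ip V" unfolding h_def by (rule direct_sum_add_in[OF H af g])
    have left: "?ip h u = a * ?ip f u + ?ip g u" if "u \<in> direct_sum M ip V" for u
      unfolding h_def direct_sum_ip_add[OF H af g that] direct_sum_ip_act[OF H f that] ..
    have right: "?ip u h = ?ip u f * star a + ?ip u g" if u: "u \<in> direct_sum M ip V" for u
      using arg_cong[OF left[OF u], of star]
      by (simp add: direct_sum_ip_star[OF H] star_add star_mult f g h u)
    have "?ip h h = a * ?ip f f * star a + a * ?ip f g + star (?ip f g) * star a + ?ip g g"
      unfolding left[OF h] right[OF f] right[OF g] direct_sum_ip_star[OF H f g]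
      by (simp add: algebra_simps)
    with direct_sum_ip_pos[OF H h h] show ?thesis by simp
  qed
  then have "(norm (?ip f g))\<^sup>2 \<le> norm (?ip f f) * norm (?ip g g)"
    by (rule cpositive_Cauchy_Schwarz[OF direct_sum_ip_pos[OF H f f]])
  then show ?thesis
    unfolding direct_sum_norm_def real_sqrt_mult[symmetric] by (rule real_le_rsqrt)
qed

text \<open>The difference of \<open>f\<close> and \<open>g\<close>, tested against itself, has
  inner product 0; definiteness holds up to null sets.\<close>

lemma direct_sum_ip_right_eqI:
  assumes H: "direct_sum_hilbert M act ip V"
    and f: "f \<in> direct_sum M ip V" and g: "g \<in> direct_sum M ip V"
    and eq: "\<And>h. h \<in> direct_sum M ip V \<Longrightarrow> direct_sum_ip M ip h f = direct_sum_ip M ip h g"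
  shows "AE m in M. f m = g m"
proof -
  let ?ip = "direct_sum_ip M ip"
  define h where "h = (\<lambda>m. f m + (-1) *\<^sub>C g m)"
  have g': "(\<lambda>m. (-1) *\<^sub>C g m) \<in> direct_sum M ip V"
    by (rule direct_sum_scaleC_in[OF H g g])
  have h: "h \<in> direct_sum M ip V"
    unfolding h_def by (rule direct_sum_add_in[OF H f g'])
  have "?ip h h = ?ip f h + (-1) *\<^sub>C ?ip g h"
    using direct_sum_ip_add[OF H f g' h] direct_sum_ip_scaleC[OF H g h] by (simp only: h_def)
  also have "\<dots> = star (?ip h f) + (-1) *\<^sub>C star (?ip h g)"
    by (simp only: direct_sum_ip_star[OF H h f] direct_sum_ip_star[OF H h g])
  finally have "?ip h h = 0" using eq[OF h] by simp
  then have "AE m in M. h m = 0" by (rule direct_sum_ip_definite[OF H h h])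
  then show ?thesis by (auto simp: h_def)
qed

text \<open>Bounded module maps into the algebra need not be given by an inner product. Existence is
  therefore asserted for the integrals, and the properties of \<open>T\<close> for every map that
  satisfies the defining equation.\<close>

theorem theorem2p10:
  fixes M :: "'m measure"
    and actU :: "'a::cstar_algebra \<Rightarrow> 'u::complex_banach \<Rightarrow> 'u" and ipU :: "'u \<Rightarrow> 'u \<Rightarrow> 'a"
    and actV :: "'a \<Rightarrow> 'v::complex_banach \<Rightarrow> 'v" and ipV :: "'v \<Rightarrow> 'v \<Rightarrow> 'a"
    and V :: "'m \<Rightarrow> 'v set" and \<Lambda> :: "'m \<Rightarrow> 'u \<Rightarrow> 'v" and B :: real
  assumes U: "hilbert_cmodule actU ipU"
    and V: "hilbert_cmodule actV ipV"
    and Vm: "\<forall>m\<in>space M. closed_submodule actV (V m)"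
    and sum: "direct_sum_hilbert M actV ipV V"
    and bessel: "cg_bessel M actU ipU actV ipV V \<Lambda> B"
  shows "(\<forall>f\<in>direct_sum M ipV V. \<forall>g. \<exists>a.
        has_weak_integral M (\<lambda>m. ipU (adjoint_op UNIV ipU (V m) ipV (\<Lambda> m) (f m)) g) a) \<and>
    (\<forall>T. cg_synthesis M ipU ipV V \<Lambda> T \<longrightarrow>
      direct_sum_bounded_linear M ipV V T \<and> direct_sum_onorm M ipV V T \<le> sqrt B \<and>
      (\<exists>T'. adjoint_pair (direct_sum M ipV V) (direct_sum_ip M ipV) UNIV ipU T T') \<and>
      (\<forall>g. (\<lambda>m. \<Lambda> m g) \<in> direct_sum M ipV V \<and>
        (AE m in M. adjoint_op (direct_sum M ipV V) (direct_sum_ip M ipV) UNIV ipU T g m = \<Lambda> m g)) \<and>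
      (\<forall>S. cg_frame_operator M ipU ipV V \<Lambda> S \<longleftrightarrow>
        S = T \<circ> adjoint_op (direct_sum M ipV V) (direct_sum_ip M ipV) UNIV ipU T))"
proof -
  interpret U: hilbert_cmodule actU ipU by (rule U)
  interpret V: hilbert_cmodule actV ipV by (rule V)
  define D where "D = direct_sum M ipV V"
  define ip where "ip = direct_sum_ip M ipV"
  define A where "A m = adjoint_op UNIV ipU (V m) ipV (\<Lambda> m)" for m
  define L where "L g = (\<lambda>m. \<Lambda> m g)" for g
  note sumD = direct_sum_hilbertD[OF sum, folded D_def ip_def]
  have B: "B > 0" using bessel by (simp add: cg_bessel_def)
  have adj: "adjoint_pair UNIV ipU (V m) ipV (\<Lambda> m) (A m)" if "m \<in> space M" for m
  proof -
    have "\<exists>L'. adjoint_pair UNIV ipU (V m) ipV (\<Lambda> m) L'"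
      using bessel that by (simp add: cg_bessel_def End_star_def)
    then show ?thesis unfolding A_def adjoint_op_def by (rule someI_ex)
  qed
  have L_in: "L g \<in> D" for g
    using bessel adj
    by (fastforce simp: D_def L_def direct_sum_def cg_bessel_def adjoint_pair_def)
  have A_ip: "ipU (A m (f m)) g = ipV (f m) (L g m)" if "f \<in> D" "m \<in> space M" for f m g
  proof -
    have "f m \<in> V m" using that by (simp add: D_def direct_sum_def)
    then have "ipV (\<Lambda> m g) (f m) = ipU g (A m (f m))"
      using adj[OF that(2)] by (simp add: adjoint_pair_def)
    then show ?thesis unfolding L_def by (metis U.ip_star V.ip_star)
  qed
  have integral: "has_weak_integral M (\<lambda>m. ipU (A m (f m)) g) (ip f (L g))" if f: "f \<in> D" for f g
  proof -
    have "has_weak_integral M (\<lambda>m. ipV (f m) (L g m)) (ip f (L g))"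
      using direct_sum_hilbert_integral[OF sum] f L_in[of g] by (simp add: D_def ip_def)
    then show ?thesis using A_ip[OF f] by (simp cong: has_weak_integral_cong)
  qed
  \<comment> \<open>The Bessel inequality lives in the order of the algebra;
    \<open>norm_le_if_cle\<close> turns it into an inequality of norms.\<close>
  have norm_L: "direct_sum_norm M ipV (L g) \<le> sqrt B * norm g" for g
  proof -
    obtain a where a: "has_weak_integral M (\<lambda>m. ipV (L g m) (L g m)) a" "cle a (B *\<^sub>R ipU g g)"
      using bessel unfolding cg_bessel_def L_def by blast
    have ip_a: "ip (L g) (L g) = a"
      using weak_integral_eq[OF a(1)] by (simp add: ip_def direct_sum_ip_def)
    moreover have "cpositive (ip (L g) (L g))" by (rule sumD(8)[OF L_in L_in])
    ultimately have "norm (ip (L g) (L g)) \<le> B * (norm g)\<^sup>2"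
      using norm_le_if_cle[OF _ a(2)] B by (simp add: U.norm_square_ip)
    then have "sqrt (norm (ip (L g) (L g))) \<le> sqrt (B * (norm g)\<^sup>2)" by simp
    then show ?thesis by (simp add: direct_sum_norm_def ip_def real_sqrt_mult)
  qed
  have main: "direct_sum_bounded_linear M ipV V T \<and> direct_sum_onorm M ipV V T \<le> sqrt B \<and>
      (\<exists>T'. adjoint_pair D ip UNIV ipU T T') \<and>
      (\<forall>g. L g \<in> D \<and> (AE m in M. adjoint_op D ip UNIV ipU T g m = L g m)) \<and>
      (\<forall>S. cg_frame_operator M ipU ipV V \<Lambda> S \<longleftrightarrow> S = T \<circ> adjoint_op D ip UNIV ipU T)"
    if syn: "cg_synthesis M ipU ipV V \<Lambda> T" for T
  proof -
    have T_integral: "has_weak_integral M (\<lambda>m. ipU (A m (f m)) g) (ipU (T f) g)" if "f \<in> D" for f g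
      using syn that by (simp add: cg_synthesis_def D_def A_def)
    have T_ip: "ipU (T f) g = ip f (L g)" if "f \<in> D" for f g
      using has_weak_integral_unique[OF T_integral integral] that by blast
    have T_AE: "T f = T g" if f: "f \<in> D" and g: "g \<in> D" and ae: "AE m in M. f m = g m" for f g
    proof (rule U.ip_left_eqI)
      fix h
      show "ipU (T f) h = ipU (T g) h"
        by (rule has_weak_integral_unique_AE[OF T_integral[OF f] T_integral[OF g]]) (use ae in auto)
    qed
    have T_add: "T (\<lambda>m. f m + g m) = T f + T g" if "f \<in> D" "g \<in> D" for f g
      using that by (intro U.ip_left_eqI) (simp add: T_ip U.ip_add_left sumD L_in)
    have T_scale: "T (\<lambda>m. c *\<^sub>C f m) = c *\<^sub>C T f" if "f \<in> D" for c f
      using that by (intro U.ip_left_eqI) (simp add: T_ip U.ip_scaleC_left sumD(2,5) L_in)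
    have norm_T: "norm (T f) \<le> sqrt B * direct_sum_norm M ipV f" if f: "f \<in> D" for f
    proof (cases "T f = 0")
      case True
      then show ?thesis using B by (simp add: direct_sum_norm_def)
    next
      case False
      have "norm (T f) * norm (T f) = norm (ip f (L (T f)))"
        using U.norm_square_ip[of "T f"] by (simp add: T_ip[OF f] power2_eq_square)
      also have "\<dots> \<le> direct_sum_norm M ipV f * direct_sum_norm M ipV (L (T f))"
        using direct_sum_Cauchy_Schwarz[OF sum] f L_in by (simp add: D_def ip_def)
      also have "\<dots> \<le> direct_sum_norm M ipV f * (sqrt B * norm (T f))"
        by (intro mult_left_mono norm_L) (simp add: direct_sum_norm_def)
      finally show ?thesis using False by (simp add: mult.commute mult.left_commute)
    qed
    have "direct_sum_bounded_linear M ipV V T"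
      using T_AE T_add T_scale norm_T unfolding direct_sum_bounded_linear_def D_def by blast
    moreover have "direct_sum_onorm M ipV V T \<le> sqrt B"
      unfolding direct_sum_onorm_def D_def[symmetric]
    proof (rule cSUP_least)
      show "D \<noteq> {}" using L_in by blast
      fix f assume f: "f \<in> D"
      show "norm (T f) / direct_sum_norm M ipV f \<le> sqrt B"
      \<comment> \<open>Division by 0 yields 0, so families of norm 0 contribute 0 to the
        supremum.\<close>
      proof (cases "direct_sum_norm M ipV f = 0")
        case False
        then have "direct_sum_norm M ipV f > 0" by (simp add: direct_sum_norm_def)
        then show ?thesis using norm_T[OF f] by (simp add: divide_le_eq)
      qed (use B in simp)
    qed
    moreover have pair: "adjoint_pair D ip UNIV ipU T L"
      by (simp add: adjoint_pair_def L_in T_ip)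
    moreover define T' where "T' = adjoint_op D ip UNIV ipU T"
    \<comment> \<open>The chosen adjoint is legitimate because \<open>L\<close> is one; it need
      agree with \<open>L\<close> only almost everywhere.\<close>
    have pair': "adjoint_pair D ip UNIV ipU T T'"
      unfolding T'_def adjoint_op_def by (rule someI[of _ L]) (rule pair)
    then have T'_in: "T' g \<in> D" for g by (simp add: adjoint_pair_def)
    have T'_AE: "AE m in M. T' g m = L g m" for g
    proof (rule direct_sum_ip_right_eqI[OF sum])
      fix h assume "h \<in> direct_sum M ipV V"
      then show "direct_sum_ip M ipV h (T' g) = direct_sum_ip M ipV h (L g)"
        using pair pair' by (simp add: adjoint_pair_def D_def ip_def)
    qed (use T'_in L_in in \<open>simp_all add: D_def\<close>)
    moreover have "cg_frame_operator M ipU ipV V \<Lambda> S \<longleftrightarrow> S = T \<circ> T'" for S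
    proof -
      \<comment> \<open>Since \<open>T\<close> respects a.e. equality, the null sets disappear and
        an exact equation results.\<close>
      have TT': "T (T' g) = T (L g)" for g
        by (rule T_AE[OF T'_in L_in T'_AE])
      \<comment> \<open>The integral defining the frame operator at \<open>f\<close> is the one
        defining \<open>T\<close> at the family \<open>L f\<close>.\<close>
      have frame: "cg_frame_operator M ipU ipV V \<Lambda> S \<longleftrightarrow>
          (\<forall>f g. has_weak_integral M (\<lambda>m. ipU (A m (L f m)) g) (ipU (S f) g))"
        by (simp add: cg_frame_operator_def A_def L_def)
      show ?thesis
      proof
        assume "cg_frame_operator M ipU ipV V \<Lambda> S"
        then have "ipU (S f) g = ipU (T (L f)) g" for f g
          unfolding frame using has_weak_integral_unique[OF _ T_integral[OF L_in]] by blast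
        then have "S f = T (L f)" for f by (rule U.ip_left_eqI)
        then show "S = T \<circ> T'" by (simp add: fun_eq_iff TT')
      next
        assume "S = T \<circ> T'"
        then show "cg_frame_operator M ipU ipV V \<Lambda> S"
          unfolding frame using T_integral[OF L_in] by (simp add: TT')
      qed
    qed
    ultimately show ?thesis using L_in unfolding T'_def by blast
  qed
  show ?thesis
    using integral main unfolding D_def ip_def A_def L_def by blast
qed

end
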